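(* Let $n\ge 1$ be an integer. Let $\{(X_i,d_i)\}_{i=1}^{n+1}$ be a sequence in $\mathscr{T}$ such that $\mathcal{GH}((X_i,d_i),(X_j,d_j))>0$ for all distinct $i,j$. Let $H$ be a compact metric space and let $v_1,\dots,v_{n+1}$ be $n+1$ different points of $H$. Then there exists a topological embedding $\Phi:H\to\mathscr{T}$ (that is, a homeomorphism onto its image) such that $\Phi(v_i)=(X_i,d_i)$ for all $i\in\{1,\dots,n+1\}$.
   Context: Geodesic segments: for a metric space $(X,d)$ and $x,y\in X$, a subset $S\subset X$ is a geodesic segment connecting $x$ and $y$ if there are a closed interval $[a,b]\subset\mathbb{R}$ and an isometric embedding $f:[a,b]\to X$ with $f(a)=x$, $f(b)=y$ and $S=f([a,b])$. A geodesic space is a metric space in which every two points are connected by a geodesic segment. Metric tree ($\mathbb{R}$-tree): a geodesic space $(X,d)$ such that for all distinct $x,y,z\in X$ and all geodesic segments $G_1$ connecting $x$ and $y$ and $G_2$ connecting $y$ and $z$ with $G_1\cap G_2=\{y\}$, the union $G_1\cup G_2$ is a geodesic segment connecting $x$ and $z$. Gromov--Hausdorff space: $\mathscr{M}$ is the set of all isometry classes of non-empty compact metric spaces, equipped with the Gromov--Hausdorff distance $\mathcal{GH}$, where $\mathcal{GH}((X,d),(Y,e))$ is the infimum of the Hausdorff distances between $i(X)$ and $j(Y)$ in $(Z,h)$ over all metric spaces $(Z,h)$ and isometric embeddings $i:X\to Z$, $j:Y\to Z$. An element of $\mathscr{M}$ is written as a pair $(X,d)$ representing its isometry class. $\mathscr{T}\subset\mathscr{M}$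 is the subset of all (isometry classes of) metric trees, with the topology induced by $\mathcal{GH}$. *)

theory Defs
  imports "HOL-Analysis.Analysis"
begin

section \<open>Isometries and metric trees\<close>

definition isometric_embedding :: "'a metric \<Rightarrow> 'b metric \<Rightarrow> ('a \<Rightarrow> 'b) \<Rightarrow> bool" where
  "isometric_embedding X Y f \<longleftrightarrow>
     f ` mspace X \<subseteq> mspace Y \<and>
     (\<forall>x\<in>mspace X. \<forall>y\<in>mspace X. mdist Y (f x) (f y) = mdist X x y)"

definition isometric :: "'a metric \<Rightarrow> 'b metric \<Rightarrow> bool" where
  "isometric X Y \<longleftrightarrow> (\<exists>f. isometric_embedding X Y f \<and> f ` mspace X = mspace Y)"

definition geodesic_segment :: "'a metric \<Rightarrow> 'a \<Rightarrow> 'a \<Rightarrow> 'a set \<Rightarrow> bool" where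
  "geodesic_segment X x y S \<longleftrightarrow>
     (\<exists>(a::real) b f. a \<le> b \<and> isometric_embedding (submetric euclidean_metric {a..b}) X f \<and>
        f a = x \<and> f b = y \<and> S = f ` {a..b})"

definition geodesic_metric :: "'a metric \<Rightarrow> bool" where
  "geodesic_metric X \<longleftrightarrow> (\<forall>x\<in>mspace X. \<forall>y\<in>mspace X. \<exists>S. geodesic_segment X x y S)"

definition metric_tree :: "'a metric \<Rightarrow> bool" where
  "metric_tree X \<longleftrightarrow> geodesic_metric X \<and>
     (\<forall>x\<in>mspace X. \<forall>y\<in>mspace X. \<forall>z\<in>mspace X. \<forall>G1 G2.
        x \<noteq> y \<longrightarrow> y \<noteq> z \<longrightarrow> x \<noteq> z \<longrightarrow>
        geodesic_segment X x y G1 \<longrightarrow> geodesic_segment X y z G2 \<longrightarrow> G1 \<inter> G2 = {y} \<longrightarrow>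
        geodesic_segment X x z (G1 \<union> G2))"


section \<open>The Gromov--Hausdorff distance\<close>

definition hausdorff_distance :: "'a metric \<Rightarrow> 'a set \<Rightarrow> 'a set \<Rightarrow> real" where
  "hausdorff_distance Z A B =
     Inf {r. 0 < r \<and> A \<subseteq> (\<Union>b\<in>B. mball_of Z b r) \<and> B \<subseteq> (\<Union>a\<in>A. mball_of Z a r)}"

text \<open>
  A definition cannot quantify over all types, so the ambient spaces \<open>Z\<close> are taken over the sum
  of the two carrier types. This loses nothing: only the part \<open>i(X) \<union> j(Y)\<close> of \<open>Z\<close> matters and it
  injects into the sum; see \<open>GH_le_hausdorff_distance\<close> below.
\<close>

definition GH :: "'a metric \<Rightarrow> 'b metric \<Rightarrow> real" where
  "GH X Y = Inf {hausdorff_distance Z (i ` mspace X) (j ` mspace Y) | (Z :: ('a + 'b) metric) i j.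
                   isometric_embedding X Z i \<and> isometric_embedding Y Z j}"

definition nonempty_compact_metric :: "'a metric \<Rightarrow> bool" where
  "nonempty_compact_metric X \<longleftrightarrow> mspace X \<noteq> {} \<and> compact_space (mtopology_of X)"

lemma isometric_embedding_comp:
  assumes "isometric_embedding X Y f" "isometric_embedding Y Z g"
  shows "isometric_embedding X Z (g \<circ> f)"
  using assms unfolding isometric_embedding_def by (auto simp: image_subset_iff)

lemma isometric_embedding_inj_on:
  assumes "isometric_embedding X Y f"
  shows "inj_on f (mspace X)"
proof (rule inj_onI)
  fix x y assume xy: "x \<in> mspace X" "y \<in> mspace X" "f x = f y"
  then have "mdist X x y = mdist Y (f y) (f y)"
    using assms unfolding isometric_embedding_def by metis
  also have "\<dots> = 0"
    using assms xy unfolding isometric_embedding_def by auto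
  finally show "x = y" using xy by simp
qed

lemma isometric_refl: "isometric X X"
  unfolding isometric_def isometric_embedding_def by (rule exI[of _ id]) auto

lemma isometric_trans: "isometric X Y \<Longrightarrow> isometric Y Z \<Longrightarrow> isometric X Z"
  unfolding isometric_def by (metis image_comp isometric_embedding_comp)

lemma isometric_embedding_inv_into:
  assumes "isometric_embedding X Y f" "f ` mspace X = mspace Y"
  shows "isometric_embedding Y X (inv_into (mspace X) f)"
  using assms unfolding isometric_embedding_def
  by (auto simp: f_inv_into_f inv_into_into)
    (metis f_inv_into_f inv_into_into)

lemma isometric_sym:
  assumes "isometric X Y" shows "isometric Y X"
proof -
  obtain f where f: "isometric_embedding X Y f" "f ` mspace X = mspace Y"
    using assms unfolding isometric_def by blast
  have "inv_into (mspace X) f ` mspace Y = mspace X"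
    using f isometric_embedding_inj_on[OF f(1)] by (metis inv_into_image_cancel order_refl)
  then show ?thesis
    unfolding isometric_def using isometric_embedding_inv_into[OF f] by blast
qed

lemma mbounded_of_compact:
  assumes "nonempty_compact_metric X"
  obtains x B where "x \<in> mspace X" "\<And>y. y \<in> mspace X \<Longrightarrow> mdist X x y \<le> B"
proof -
  interpret Metric_space "mspace X" "mdist X" by simp
  obtain x where x: "x \<in> mspace X"
    using assms by (auto simp: nonempty_compact_metric_def)
  have "compactin mtopology (mspace X)"
    using assms by (simp add: nonempty_compact_metric_def compact_space_def mtopology_of_def)
  then have "mbounded (mspace X)" by (rule compactin_imp_mbounded)
  then obtain B where "\<forall>x\<in>mspace X. \<forall>y\<in>mspace X. mdist X x y \<le> B"
    using mbounded_alt by metis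
  then show thesis using that x by blast
qed

lemma isometric_copy_on_image:
  assumes "inj_on g (mspace X)"
  obtains Y where "mspace Y = g ` mspace X" "isometric_embedding X Y g"
proof -
  define h where "h = inv_into (mspace X) g"
  have h: "h (g x) = x" if "x \<in> mspace X" for x
    using that assms by (simp add: h_def)
  interpret Y: Metric_space "g ` mspace X" "\<lambda>p q. mdist X (h p) (h q)"
  proof
    fix p q r
    show "mdist X (h p) (h q) = mdist X (h q) (h p)" by (simp add: mdist_commute)
    assume "p \<in> g ` mspace X" "q \<in> g ` mspace X"
    then show "mdist X (h p) (h q) = 0 \<longleftrightarrow> p = q" by (auto simp: h)
    assume "r \<in> g ` mspace X"
    with \<open>p \<in> _\<close> \<open>q \<in> _\<close> show "mdist X (h p) (h r) \<le> mdist X (h p) (h q) + mdist X (h q) (h r)"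
      by (auto simp: h mdist_triangle)
  qed simp
  show thesis
    by (rule that[of "metric (g ` mspace X, \<lambda>p q. mdist X (h p) (h q))"])
      (auto simp: isometric_embedding_def h)
qed

lemma hausdorff_distance_isometric_embedding:
  assumes "isometric_embedding Z W g" "A \<subseteq> mspace Z" "B \<subseteq> mspace Z"
  shows "hausdorff_distance W (g ` A) (g ` B) = hausdorff_distance Z A B"
proof -
  have 1: "g ` A \<subseteq> (\<Union>b\<in>g ` B. mball_of W b r) \<longleftrightarrow> A \<subseteq> (\<Union>b\<in>B. mball_of Z b r)"
    if "A \<subseteq> mspace Z" "B \<subseteq> mspace Z" for A B r
  proof -
    have iff: "g a \<in> mball_of W (g b) r \<longleftrightarrow> a \<in> mball_of Z b r" if "a \<in> A" "b \<in> B" for a b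
      using that \<open>A \<subseteq> _\<close> \<open>B \<subseteq> _\<close> assms(1)
      by (auto simp: isometric_embedding_def subset_iff image_subset_iff)
    show ?thesis by (auto simp: subset_eq iff simp del: in_mball_of)
  qed
  show ?thesis
    unfolding hausdorff_distance_def 1[OF assms(2,3)] 1[OF assms(3,2)] ..
qed

lemma hausdorff_distance_nonneg:
  assumes X: "nonempty_compact_metric X" "isometric_embedding X Z i"
    and Y: "nonempty_compact_metric Y" "isometric_embedding Y Z j"
  shows "0 \<le> hausdorff_distance Z (i ` mspace X) (j ` mspace Y)"
proof -
  let ?S = "{r. 0 < r \<and> i ` mspace X \<subseteq> (\<Union>b\<in>j ` mspace Y. mball_of Z b r) \<and>
                   j ` mspace Y \<subseteq> (\<Union>a\<in>i ` mspace X. mball_of Z a r)}"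
  obtain x B where x: "x \<in> mspace X" "\<And>y. y \<in> mspace X \<Longrightarrow> mdist X x y \<le> B"
    using mbounded_of_compact[OF X(1)] by blast
  obtain y C where y: "y \<in> mspace Y" "\<And>z. z \<in> mspace Y \<Longrightarrow> mdist Y y z \<le> C"
    using mbounded_of_compact[OF Y(1)] by blast
  define r where "r = B + C + mdist Z (i x) (j y) + 1"
  have i: "i z \<in> mspace Z" "mdist Z (i x) (i z) \<le> B" if "z \<in> mspace X" for z
    using that x X(2) by (auto simp: isometric_embedding_def)
  have j: "j z \<in> mspace Z" "mdist Z (j y) (j z) \<le> C" if "z \<in> mspace Y" for z
    using that y Y(2) by (auto simp: isometric_embedding_def)
  have BC: "0 \<le> B" "0 \<le> C" 
    by (rule order_trans[OF mdist_nonneg x(2)[OF x(1)]], rule order_trans[OF mdist_nonneg y(2)[OF y(1)]])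
  have r: "0 < r" unfolding r_def using BC mdist_nonneg[of Z "i x" "j y"] by linarith
  have "mdist Z (j y) (i z) < r" if "z \<in> mspace X" for z
    using mdist_triangle[OF j(1)[OF y(1)] i(1)[OF x(1)] i(1)[OF that]] i(2)[OF that] BC
    by (simp add: r_def mdist_commute)
  moreover have "mdist Z (i x) (j z) < r" if "z \<in> mspace Y" for z
    using mdist_triangle[OF i(1)[OF x(1)] j(1)[OF y(1)] j(1)[OF that]] j(2)[OF that] BC
    by (simp add: r_def)
  ultimately have "i ` mspace X \<subseteq> mball_of Z (j y) r" "j ` mspace Y \<subseteq> mball_of Z (i x) r"
    using i(1) j(1) x(1) y(1) by auto
  then have "r \<in> ?S" using r x(1) y(1) by blast
  then show ?thesis
    unfolding hausdorff_distance_def by (intro cInf_greatest) auto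
qed

lemma GH_le_hausdorff_distance:
  fixes X :: "'a metric" and Y :: "'b metric" and Z :: "'c metric"
  assumes X: "nonempty_compact_metric X" "isometric_embedding X Z i"
    and Y: "nonempty_compact_metric Y" "isometric_embedding Y Z j"
  shows "GH X Y \<le> hausdorff_distance Z (i ` mspace X) (j ` mspace Y)"
proof -
  define A where "A = i ` mspace X \<union> j ` mspace Y"
  define Z0 where "Z0 = submetric Z A"
  have A: "A \<subseteq> mspace Z" using X Y by (auto simp: A_def isometric_embedding_def)
  have i: "isometric_embedding X Z0 i" and j: "isometric_embedding Y Z0 j"
    using X Y A by (auto simp: Z0_def A_def isometric_embedding_def)
  define g :: "'c \<Rightarrow> 'a + 'b" where
    "g = (\<lambda>z. if z \<in> i ` mspace X then Inl (inv_into (mspace X) i z)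
              else Inr (inv_into (mspace Y) j z))"
  have "inj_on g (mspace Z0)"
  proof (rule inj_onI)
    fix z w assume "z \<in> mspace Z0" "w \<in> mspace Z0" and eq: "g z = g w"
    then have "z \<in> A" "w \<in> A" by (auto simp: Z0_def)
    then show "z = w"
      using eq unfolding g_def A_def by (auto split: if_splits dest: inv_into_injective)
  qed
  then obtain W where W: "mspace W = g ` mspace Z0" "isometric_embedding Z0 W g"
    by (rule isometric_copy_on_image)
  have WX: "isometric_embedding X W (g \<circ> i)" and WY: "isometric_embedding Y W (g \<circ> j)"
    using i j W(2) by (auto intro: isometric_embedding_comp)
  have "hausdorff_distance W ((g \<circ> i) ` mspace X) ((g \<circ> j) ` mspace Y)
      = hausdorff_distance Z0 (i ` mspace X) (j ` mspace Y)"
    using hausdorff_distance_isometric_embedding[OF W(2), of "i ` mspace X" "j ` mspace Y"] i j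
    by (simp add: image_comp isometric_embedding_def)
  also have "\<dots> = hausdorff_distance Z (i ` mspace X) (j ` mspace Y)"
    using hausdorff_distance_isometric_embedding[of Z0 Z id "i ` mspace X" "j ` mspace Y"] i j
    by (simp add: isometric_embedding_def Z0_def)
  finally have eq: "hausdorff_distance Z (i ` mspace X) (j ` mspace Y)
      = hausdorff_distance W ((g \<circ> i) ` mspace X) ((g \<circ> j) ` mspace Y)" ..
  show ?thesis
    unfolding GH_def eq
  proof (rule cInf_lower)
    show "bdd_below {hausdorff_distance Z (i ` mspace X) (j ` mspace Y) | (Z :: ('a + 'b) metric) i j.
            isometric_embedding X Z i \<and> isometric_embedding Y Z j}"
      by (rule bdd_belowI[of _ 0]) (auto intro: hausdorff_distance_nonneg[OF X(1) _ Y(1)])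
    show "hausdorff_distance W ((g \<circ> i) ` mspace X) ((g \<circ> j) ` mspace Y) \<in> {hausdorff_distance Z (i ` mspace X) (j ` mspace Y) | (Z :: ('a + 'b) metric) i j.
            isometric_embedding X Z i \<and> isometric_embedding Y Z j}"
      by (rule CollectI, intro exI conjI, rule refl, fact WX, fact WY)
  qed
qed

lemma GH_isometric:
  fixes X X' :: "'a metric" and Y Y' :: "'b metric"
  assumes "isometric X X'" "isometric Y Y'"
  shows "GH X Y = GH X' Y'"
proof -
  let ?S = "\<lambda>X Y. {hausdorff_distance Z (i ` mspace X) (j ` mspace Y) | (Z :: ('a + 'b) metric) i j.
                   isometric_embedding X Z i \<and> isometric_embedding Y Z j}"
  have sub: "?S X' Y' \<subseteq> ?S X Y"
    if iso: "isometric X X'" "isometric Y Y'" for X X' :: "'a metric" and Y Y' :: "'b metric"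
  proof -
    obtain f g where f: "isometric_embedding X X' f" "f ` mspace X = mspace X'"
      and g: "isometric_embedding Y Y' g" "g ` mspace Y = mspace Y'"
      using iso unfolding isometric_def by blast
    show ?thesis
    proof clarify
      fix Z :: "('a + 'b) metric" and i j
      assume ij: "isometric_embedding X' Z i" "isometric_embedding Y' Z j"
      show "\<exists>(Z' :: ('a + 'b) metric) i' j'. hausdorff_distance Z (i ` mspace X') (j ` mspace Y')
              = hausdorff_distance Z' (i' ` mspace X) (j' ` mspace Y)
            \<and> isometric_embedding X Z' i' \<and> isometric_embedding Y Z' j'"
        using isometric_embedding_comp[OF f(1) ij(1)] isometric_embedding_comp[OF g(1) ij(2)]
        by - (intro exI[of _ Z] exI[of _ "i \<circ> f"] exI[of _ "j \<circ> g"],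
            simp flip: f(2) g(2) add: image_comp)
    qed
  qed
  have "?S X Y = ?S X' Y'"
    using sub[OF assms] sub[OF isometric_sym[OF assms(1)] isometric_sym[OF assms(2)]] by blast
  then show ?thesis by (simp add: GH_def)
qed

lemma geodesic_segment_subset: "geodesic_segment X x y S \<Longrightarrow> S \<subseteq> mspace X"
  by (auto simp: geodesic_segment_def isometric_embedding_def)

lemma geodesic_segment_image:
  assumes "geodesic_segment X x y S" "isometric_embedding X Y f"
  shows "geodesic_segment Y (f x) (f y) (f ` S)"
proof -
  obtain a b :: real and h where
    h: "a \<le> b" "isometric_embedding (submetric euclidean_metric {a..b}) X h"
       "h a = x" "h b = y" "S = h ` {a..b}"
    using assms(1) unfolding geodesic_segment_def by blast
  then show ?thesis
    unfolding geodesic_segment_def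
    using isometric_embedding_comp[OF h(2) assms(2)]
    by - (intro exI[of _ a] exI[of _ b] exI[of _ "f \<circ> h"], auto simp: image_comp)
qed

lemma metric_tree_isometric:
  assumes "isometric X Y" "metric_tree X"
  shows "metric_tree Y"
proof -
  obtain f where f: "isometric_embedding X Y f" "f ` mspace X = mspace Y"
    using assms(1) unfolding isometric_def by blast
  define g where "g = inv_into (mspace X) f"
  have g: "isometric_embedding Y X g"
    unfolding g_def by (rule isometric_embedding_inv_into[OF f])
  have fg: "f (g y) = y" if "y \<in> mspace Y" for y
    using f_inv_into_f[of y f "mspace X"] that f(2) by (simp add: g_def)
  have gY: "g y \<in> mspace X" if "y \<in> mspace Y" for y
    using inv_into_into[of y f "mspace X"] that f(2) by (simp add: g_def)
  have fgS: "f ` g ` S = S" if "S \<subseteq> mspace Y" for S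
  proof -
    have "f ` g ` S = (\<lambda>y. y) ` S"
      unfolding image_image by (rule image_cong) (use that fg in auto)
    then show ?thesis by simp
  qed
  have geoX: "geodesic_metric X"
    using assms(2) by (simp add: metric_tree_def)
  have treeX: "geodesic_segment X x z (G1 \<union> G2)"
    if "x \<in> mspace X" "y \<in> mspace X" "z \<in> mspace X" "x \<noteq> y" "y \<noteq> z" "x \<noteq> z"
      "geodesic_segment X x y G1" "geodesic_segment X y z G2" "G1 \<inter> G2 = {y}" for x y z G1 G2
    using assms(2) that unfolding metric_tree_def by simp
  have "geodesic_metric Y"
    unfolding geodesic_metric_def
  proof (intro ballI)
    fix x y assume xy: "x \<in> mspace Y" "y \<in> mspace Y"
    then obtain S where "geodesic_segment X (g x) (g y) S"
      using geoX gY unfolding geodesic_metric_def by meson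
    then have "geodesic_segment Y (f (g x)) (f (g y)) (f ` S)"
      by (rule geodesic_segment_image[OF _ f(1)])
    then show "\<exists>S. geodesic_segment Y x y S"
      unfolding fg[OF xy(1)] fg[OF xy(2)] ..
  qed
  moreover have "geodesic_segment Y x z (G1 \<union> G2)"
    if xyz: "x \<in> mspace Y" "y \<in> mspace Y" "z \<in> mspace Y" "x \<noteq> y" "y \<noteq> z" "x \<noteq> z"
      and G: "geodesic_segment Y x y G1" "geodesic_segment Y y z G2" "G1 \<inter> G2 = {y}" for x y z G1 G2
  proof -
    have sub: "G1 \<subseteq> mspace Y" "G2 \<subseteq> mspace Y"
      using geodesic_segment_subset[OF G(1)] geodesic_segment_subset[OF G(2)] .
    have "g ` G1 \<inter> g ` G2 = g ` (G1 \<inter> G2)"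
      using inj_on_image_Int[OF isometric_embedding_inj_on[OF g] sub] by simp
    then have Int: "g ` G1 \<inter> g ` G2 = {g y}" using G(3) by simp
    have neq: "g x \<noteq> g y" "g y \<noteq> g z" "g x \<noteq> g z"
      using xyz(4-6) fg[OF xyz(1)] fg[OF xyz(2)] fg[OF xyz(3)] by auto
    have "geodesic_segment X (g x) (g z) (g ` G1 \<union> g ` G2)"
      by (rule treeX[OF gY[OF xyz(1)] gY[OF xyz(2)] gY[OF xyz(3)] neq
            geodesic_segment_image[OF G(1) g] geodesic_segment_image[OF G(2) g] Int])
    from geodesic_segment_image[OF this f(1)] show ?thesis
      unfolding image_Un fg[OF xyz(1)] fg[OF xyz(3)] fgS[OF sub(1)] fgS[OF sub(2)] .
  qed
  ultimately show ?thesis unfolding metric_tree_def by simp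
qed

lemma metric_tree_isometric_iff: "isometric X Y \<Longrightarrow> metric_tree X \<longleftrightarrow> metric_tree Y"
  using metric_tree_isometric[of X Y] metric_tree_isometric[of Y X] isometric_sym[of X Y] by argo


section \<open>The Gromov--Hausdorff space\<close>

text \<open>
  Every compact metric space has at most the cardinality of the continuum, so every isometry class
  of non-empty compact metric spaces has a representative whose points are real numbers (with an
  arbitrary metric, unrelated to the usual one); see \<open>isometric_real_metric\<close> below. Hence the
  quotient of the non-empty compact members of \<^typ>\<open>real metric\<close> by isometry contains all
  isometry classes.
\<close>

lemma isometric_real_metric:
  fixes X :: "'a metric"
  assumes "nonempty_compact_metric X"
  shows "\<exists>R :: real metric. nonempty_compact_metric R \<and> isometric X R"
proof -
  interpret X: Metric_space "mspace X" "mdist X" by simp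
  have cpt: "compact_space X.mtopology"
    using assms by (simp add: nonempty_compact_metric_def mtopology_of_def)
  then have "X.mtotally_bounded (mspace X)"
    by (simp add: X.compact_space_eq_mcomplete_mtotally_bounded)
  then have "\<forall>n::nat. \<exists>K. finite K \<and> K \<subseteq> mspace X \<and> mspace X \<subseteq> (\<Union>x\<in>K. X.mball x (1 / Suc n))"
    unfolding X.mtotally_bounded_def by (meson divide_pos_pos of_nat_0_less_iff zero_less_Suc zero_less_one)
  then obtain K where K: "\<And>n::nat. finite (K n)" "\<And>n. K n \<subseteq> mspace X"
    "\<And>n. mspace X \<subseteq> (\<Union>x\<in>K n. X.mball x (1 / Suc n))"
    by metis
  define D where "D = (\<Union>n. K n)"
  have D: "countable D" unfolding D_def by (rule countable_UN) (simp_all add: countable_finite K(1))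
  define F where "F x = {k. \<exists>m n. k = prod_encode (m, n) \<and>
                    mdist X (from_nat_into D m) x < 1 / Suc n}" for x
  have F: "inj_on F (mspace X)"
  proof (rule inj_onI, rule ccontr)
    fix x y assume xy: "x \<in> mspace X" "y \<in> mspace X" "F x = F y" "x \<noteq> y"
    then have "0 < mdist X x y / 2" by simp
    then obtain n where n: "1 / Suc n < mdist X x y / 2"
      by (rule nat_approx_posE)
    obtain p where p: "p \<in> K n" "mdist X p x < 1 / Suc n"
      using subsetD[OF K(3)[of n] xy(1)] by auto
    then have "p \<in> D" by (auto simp: D_def)
    from from_nat_into_surj[OF D this] obtain m where m: "from_nat_into D m = p" ..
    have "prod_encode (m, n) \<in> F x" using p(2) unfolding m[symmetric] by (auto simp: F_def)
    then have "prod_encode (m, n) \<in> F y" using xy(3) by simp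
    then have "mdist X p y < 1 / Suc n" using m by (auto simp: F_def)
    moreover have "mdist X x y \<le> mdist X p x + mdist X p y"
      using X.triangle''[of x p y] subsetD[OF K(2) p(1)] xy(1,2) by simp
    ultimately show False using p(2) n by simp
  qed
  obtain e :: "nat set \<Rightarrow> real" where "inj e"
    using nat_sets_lepoll_reals01 unfolding lepoll_def by auto
  then have "inj_on (e \<circ> F) (mspace X)"
    by (rule comp_inj_on[OF F inj_on_subset[OF _ subset_UNIV]])
  then obtain R where R: "mspace R = (e \<circ> F) ` mspace X" "isometric_embedding X R (e \<circ> F)"
    by (rule isometric_copy_on_image)
  interpret XR: Metric_space12 "mspace X" "mdist X" "mspace R" "mdist R"
    by (simp add: Metric_space12_def)
  have hom: "homeomorphic_map X.mtopology XR.M2.mtopology (e \<circ> F)"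
    using R by (intro XR.isometry_imp_homeomorphic_map) (auto simp: isometric_embedding_def)
  have "compact_space XR.M2.mtopology"
    using homeomorphic_compact_space[OF homeomorphic_map_imp_homeomorphic_space[OF hom]] cpt by argo
  then have "nonempty_compact_metric R"
    using R(1) assms by (simp add: nonempty_compact_metric_def mtopology_of_def)
  moreover have "isometric X R"
    unfolding isometric_def by (rule exI[of _ "e \<circ> F"]) (simp add: R)
  ultimately show ?thesis by auto
qed

definition isometric_compact :: "real metric \<Rightarrow> real metric \<Rightarrow> bool" where
  "isometric_compact X Y \<longleftrightarrow>
     nonempty_compact_metric X \<and> nonempty_compact_metric Y \<and> isometric X Y"

quotient_type gh_space = "real metric" / partial: isometric_compact
proof (rule part_equivpI)
  have "nonempty_compact_metric (submetric euclidean_metric {0::real})"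
    by (simp add: nonempty_compact_metric_def mtopology_of_submetric compact_space_subtopology)
  then show "\<exists>X. isometric_compact X X"
    unfolding isometric_compact_def using isometric_refl by blast
  show "symp isometric_compact"
    by (rule sympI) (simp add: isometric_compact_def isometric_sym)
  show "transp isometric_compact"
  proof (rule transpI)
    fix X Y Z assume "isometric_compact X Y" "isometric_compact Y Z"
    then show "isometric_compact X Z"
      using isometric_trans[of X Y Z] by (simp add: isometric_compact_def)
  qed
qed

lift_definition gh_dist :: "gh_space \<Rightarrow> gh_space \<Rightarrow> real" is GH
  by (rule GH_isometric) (simp_all add: isometric_compact_def)

lift_definition is_metric_tree :: "gh_space \<Rightarrow> bool" is metric_tree
  by (rule metric_tree_isometric_iff) (simp add: isometric_compact_def)

definition metric_trees :: "gh_space set" where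
  "metric_trees = {T. is_metric_tree T}"

text \<open>
  \<open>Metric_space.mtopology\<close> is the family of sets that contain, with every point, a ball around
  it, so the definition makes sense before \<open>gh_dist\<close> has been shown to be a metric.
\<close>

definition gh_topology :: "gh_space topology" where
  "gh_topology = Metric_space.mtopology UNIV gh_dist"

definition tree_topology :: "gh_space topology" where
  "tree_topology = subtopology gh_topology metric_trees"

end

theory Submission
  imports Defs
begin

text \<open>
  Glue the prescribed trees \<open>X\<^sub>i\<close> and countably many segments (legs) at a common root. For \<open>x \<in> H\<close>,
  cut the copy of \<open>X\<^sub>i\<close> off at a radius that is a large multiple of \<open>\<Prod>l\<noteq>i. d(x, v\<^sub>l)\<close>, and the
  legs of level \<open>j\<close> at length \<open>min (\<Prod>l. d(x, v\<^sub>l)) (len j x)\<close>, where \<open>len j x\<close> lies between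
  \<open>(1/2)^(j+1)\<close> and \<open>(1/2)^j\<close> and increases with the distance from \<open>x\<close> to the \<open>j\<close>-th term of a
  sequence that repeats every point of a countable dense set infinitely often. What remains is a
  compact tree \<open>\<Phi>(x)\<close> that depends continuously on \<open>x\<close>, and at \<open>v\<^sub>i\<close> only \<open>X\<^sub>i\<close> survives.

  If \<open>x\<close> is not one of the \<open>v\<^sub>i\<close> and \<open>y \<noteq> x\<close>, then \<open>len j y < len j x\<close> for infinitely many \<open>j\<close>, and
  for large such \<open>j\<close> the tips of the legs of level \<open>j\<close> are points of \<open>\<Phi>(x)\<close> at mutual distance
  greater than \<open>2 len j y\<close>. In \<open>\<Phi>(y)\<close> all legs of level at least \<open>j\<close> lie in a ball of radius
  \<open>len j y\<close>, so the number of points so separated is bounded in terms of the \<open>X\<^sub>i\<close> and the earlier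
  levels; level \<open>j\<close> has more legs than that. Hence \<open>\<Phi>\<close> is injective, and a continuous injection of
  a compact space into a metric space is an embedding.
\<close>


section \<open>Separated sets\<close>

lemma mdist_self [simp]: "x \<in> mspace X \<Longrightarrow> mdist X x x = 0"
  by simp

text \<open>Isometric embeddings preserve these sets, so their sizes can tell spaces apart. The
  inequality is strict so that a closed ball of radius \<open>c\<close> holds at most one point of a
  \<open>2 * c\<close>-separated set.\<close>

definition separated :: "'a metric \<Rightarrow> real \<Rightarrow> 'a set \<Rightarrow> bool" where
  "separated X r S \<longleftrightarrow> S \<subseteq> mspace X \<and> pairwise (\<lambda>x y. r < mdist X x y) S"

lemma mdist_pos: "x \<in> mspace X \<Longrightarrow> y \<in> mspace X \<Longrightarrow> x \<noteq> y \<Longrightarrow> 0 < mdist X x y"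
  using mdist_zero[of x X y] mdist_nonneg[of X x y] by linarith

lemma isometric_embedding_imp_continuous_map:
  assumes "isometric_embedding X Y f"
  shows "continuous_map (mtopology_of X) (mtopology_of Y) f"
proof -
  interpret X: Metric_space "mspace X" "mdist X" by simp
  show ?thesis
    unfolding mtopology_of_def X.metric_continuous_map[OF Metric_space_mspace_mdist]
    using assms by (auto simp: isometric_embedding_def image_subset_iff)
qed

lemma finite_net:
  assumes "nonempty_compact_metric X" "0 < r"
  obtains K where "finite K" "K \<subseteq> mspace X" "\<And>x. x \<in> mspace X \<Longrightarrow> \<exists>k\<in>K. mdist X k x < r"
proof -
  interpret X: Metric_space "mspace X" "mdist X" by simp
  have "X.mtotally_bounded (mspace X)"
    using assms by (simp add: nonempty_compact_metric_def mtopology_of_def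
        X.compact_space_eq_mcomplete_mtotally_bounded)
  then obtain K where K: "finite K" "K \<subseteq> mspace X" "mspace X \<subseteq> (\<Union>x\<in>K. X.mball x r)"
    using assms(2) unfolding X.mtotally_bounded_def by meson
  show thesis
    by (rule that[OF K(1,2)]) (use K(3) in force)
qed

lemma separated_mono: "separated X r A \<Longrightarrow> s \<le> r \<Longrightarrow> separated X s A"
  unfolding separated_def by (auto elim!: pairwise_mono)

text \<open>Each point goes to a net centre within \<open>r / 2\<close>; two points with the same
  centre would be less than \<open>r\<close> apart, so a separated set injects into the net.\<close>

lemma separated_card_bound:
  assumes "nonempty_compact_metric X" "0 < r"
  shows "\<exists>N. \<forall>S. separated X r S \<longrightarrow> finite S \<and> card S \<le> N"
proof -
  obtain K where K: "finite K" "K \<subseteq> mspace X" "\<And>x. x \<in> mspace X \<Longrightarrow> \<exists>k\<in>K. mdist X k x < r / 2"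
    using finite_net[OF assms(1), of "r / 2"] assms(2) by auto
  then obtain c where c: "\<And>x. x \<in> mspace X \<Longrightarrow> c x \<in> K \<and> mdist X (c x) x < r / 2"
    by metis
  have "finite S \<and> card S \<le> card K" if S: "separated X r S" for S
  proof -
    have "inj_on c S"
    proof (rule inj_onI, rule ccontr)
      fix x y assume xy: "x \<in> S" "y \<in> S" "c x = c y" "x \<noteq> y"
      then have "x \<in> mspace X" "y \<in> mspace X" "r < mdist X x y"
        using S by (auto simp: separated_def pairwise_def)
      then show False
        using c[of x] c[of y] xy(3) mdist_triangle[of x X "c x" y] K(2)
        by (auto simp: mdist_commute)
    qed
    moreover have "c ` S \<subseteq> K" using c S by (auto simp: separated_def)
    ultimately show ?thesis using K(1) by (meson card_inj_on_le inj_on_finite)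
  qed
  then show ?thesis by blast
qed

text \<open>The finite nets of mesh \<open>1 / Suc n\<close> have a countable, dense and non-empty
  union, which \<open>from_nat_into\<close> enumerates.\<close>

lemma dense_sequence:
  assumes "nonempty_compact_metric H"
  obtains q :: "nat \<Rightarrow> 'h" where "\<And>k. q k \<in> mspace H"
    "\<And>x e. x \<in> mspace H \<Longrightarrow> 0 < e \<Longrightarrow> \<exists>k. mdist H (q k) x < e"
proof -
  have "\<exists>K. finite K \<and> K \<subseteq> mspace H \<and> (\<forall>x\<in>mspace H. \<exists>k\<in>K. mdist H k x < 1 / Suc n)" for n :: nat
  proof -
    have "0 < 1 / real (Suc n)" by simp
    then obtain K where "finite K" "K \<subseteq> mspace H" "\<And>x. x \<in> mspace H \<Longrightarrow> \<exists>k\<in>K. mdist H k x < 1 / real (Suc n)"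
      using finite_net[OF assms] by blast
    then show ?thesis by blast
  qed
  then obtain K where K: "\<And>n. finite (K n)" "\<And>n. K n \<subseteq> mspace H"
    "\<And>n x. x \<in> mspace H \<Longrightarrow> \<exists>k\<in>K n. mdist H k x < 1 / Suc n" by metis
  define D where "D = (\<Union>n. K n)"
  have D: "countable D" unfolding D_def by (rule countable_UN) (simp_all add: countable_finite K(1))
  obtain x0 where "x0 \<in> mspace H" using assms by (auto simp: nonempty_compact_metric_def)
  then have ne: "D \<noteq> {}" using K(3)[of x0 0] by (auto simp: D_def)
  show thesis
  proof (rule that[of "from_nat_into D"])
    show "from_nat_into D k \<in> mspace H" for k
      using from_nat_into[OF ne, of k] K(2) by (auto simp: D_def)
    fix x and e :: real assume "x \<in> mspace H" "0 < e"
    obtain n where n: "1 / real (Suc n) < e" using \<open>0 < e\<close> by (rule nat_approx_posE)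
    obtain p where p: "p \<in> K n" "mdist H p x < 1 / Suc n" using K(3)[OF \<open>x \<in> mspace H\<close>] by blast
    then have "p \<in> D" by (auto simp: D_def)
    then obtain k where "from_nat_into D k = p" using from_nat_into_surj[OF D] by blast
    then show "\<exists>k. mdist H (from_nat_into D k) x < e" using p(2) n by (intro exI[of _ k]) simp
  qed
qed

lemma separated_image:
  assumes "isometric_embedding X Y f" "separated X r S"
  shows "separated Y r (f ` S)" "card (f ` S) = card S"
proof -
  have "inj_on f S"
    using isometric_embedding_inj_on[OF assms(1)] assms(2)
    by (auto simp: separated_def intro: inj_on_subset)
  then show "card (f ` S) = card S" by (rule card_image)
  show "separated Y r (f ` S)"
    using assms unfolding separated_def isometric_embedding_def pairwise_def
    by (auto simp: subset_iff)
qed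

text \<open>A point \<open>p\<close> outside the compact image has positive distance from it, so the
  orbit of \<open>p\<close> under \<open>f\<close> would be an infinite separated set.\<close>

lemma isometric_self_embedding_surj:
  assumes X: "nonempty_compact_metric X" and f: "isometric_embedding X X f"
  shows "f ` mspace X = mspace X"
proof (rule ccontr)
  interpret X: Metric_space "mspace X" "mdist X" by simp
  assume "f ` mspace X \<noteq> mspace X"
  then obtain p where p: "p \<in> mspace X" "p \<notin> f ` mspace X"
    using f by (auto simp: isometric_embedding_def)
  have "continuous_map X.mtopology X.mtopology f"
    using isometric_embedding_imp_continuous_map[OF f] by (simp add: mtopology_of_def)
  then have "compactin X.mtopology (f ` mspace X)"
    using X image_compactin[of X.mtopology "mspace X" X.mtopology f]
    by (simp add: nonempty_compact_metric_def compact_space_def mtopology_of_def)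
  then have "closedin X.mtopology (f ` mspace X)"
    by (rule compactin_imp_closedin[OF X.Hausdorff_space_mtopology])
  then obtain r where r: "0 < r" "disjnt (f ` mspace X) (X.mball p r)"
    using p by (auto simp: X.closedin_metric)
  have fX: "(f ^^ n) x \<in> mspace X" if "x \<in> mspace X" for x n
    using that f by (induction n) (auto simp: isometric_embedding_def)
  have fd: "mdist X ((f ^^ n) x) ((f ^^ n) y) = mdist X x y"
    if "x \<in> mspace X" "y \<in> mspace X" for x y n
    using that f fX by (induction n) (auto simp: isometric_embedding_def)
  \<comment> \<open>Cancelling \<open>f ^^ m\<close> turns this distance into the one from
    \<open>p\<close> to \<open>(f ^^ Suc k) p\<close>, which is a point of the image.\<close>
  have far: "r / 2 < mdist X ((f ^^ m) p) ((f ^^ n) p)" if mn: "m < n" for m n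
  proof -
    obtain k where k: "n = m + Suc k" using mn less_iff_Suc_add[of m n] by auto
    have "mdist X ((f ^^ m) p) ((f ^^ n) p) = mdist X p (f ((f ^^ k) p))"
      unfolding k funpow_add using fd[OF p(1) fX[OF p(1), of "Suc k"], of m] by simp
    moreover have "f ((f ^^ k) p) \<notin> X.mball p r"
      using r(2) imageI[OF fX[OF p(1), of k], of f] unfolding disjnt_iff by blast
    ultimately show ?thesis
      using p(1) fX[OF p(1), of "Suc k"] r(1) by auto
  qed
  then have far': "r / 2 < mdist X ((f ^^ m) p) ((f ^^ n) p)" if "m \<noteq> n" for m n
    using that by (metis mdist_commute nat_neq_iff)
  have "inj (\<lambda>n. (f ^^ n) p)"
  proof (rule injI, rule ccontr)
    fix m n assume "(f ^^ m) p = (f ^^ n) p" "m \<noteq> n"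
    then show False using far'[of m n] fX[OF p(1)] r(1) by simp
  qed
  then have "infinite (range (\<lambda>n. (f ^^ n) p))"
    by (rule range_inj_infinite)
  moreover have "separated X (r / 2) (range (\<lambda>n. (f ^^ n) p))"
    unfolding separated_def pairwise_def
  proof (intro conjI ballI impI)
    fix x y assume "x \<in> range (\<lambda>n. (f ^^ n) p)" "y \<in> range (\<lambda>n. (f ^^ n) p)" "x \<noteq> y"
    then obtain m n where "x = (f ^^ m) p" "y = (f ^^ n) p" "m \<noteq> n" by blast
    then show "r / 2 < mdist X x y" using far' by simp
  qed (use fX[OF p(1)] in blast)
  moreover obtain N where "\<And>S. separated X (r / 2) S \<Longrightarrow> finite S \<and> card S \<le> N"
    using separated_card_bound[OF X, of "r / 2"] r(1) by auto
  ultimately show False by blast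
qed


section \<open>The Gromov--Hausdorff distance in terms of correspondences\<close>

text \<open>The distortion bound is \<open>2 * r\<close> rather than \<open>r\<close>, so that
  \<open>r\<close> itself bounds the Gromov-Hausdorff distance.\<close>

definition correspondence :: "'a metric \<Rightarrow> 'b metric \<Rightarrow> real \<Rightarrow> ('a \<times> 'b) set \<Rightarrow> bool" where
  "correspondence X Y r R \<longleftrightarrow> R \<subseteq> mspace X \<times> mspace Y \<and>
     (\<forall>x\<in>mspace X. \<exists>y. (x, y) \<in> R) \<and> (\<forall>y\<in>mspace Y. \<exists>x. (x, y) \<in> R) \<and>
     (\<forall>x y x' y'. (x, y) \<in> R \<longrightarrow> (x', y') \<in> R \<longrightarrow> \<bar>mdist X x x' - mdist Y y y'\<bar> \<le> 2 * r)"

lemma correspondenceI: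
  assumes "\<And>x y. (x, y) \<in> R \<Longrightarrow> x \<in> mspace X \<and> y \<in> mspace Y"
    and "\<And>x. x \<in> mspace X \<Longrightarrow> \<exists>y. (x, y) \<in> R" "\<And>y. y \<in> mspace Y \<Longrightarrow> \<exists>x. (x, y) \<in> R"
    and "\<And>x y x' y'. (x, y) \<in> R \<Longrightarrow> (x', y') \<in> R \<Longrightarrow> \<bar>mdist X x x' - mdist Y y y'\<bar> \<le> 2 * r"
  shows "correspondence X Y r R"
  unfolding correspondence_def using assms by (intro conjI ballI allI impI) auto

lemma correspondenceD:
  assumes "correspondence X Y r R"
  shows "(x, y) \<in> R \<Longrightarrow> x \<in> mspace X" "(x, y) \<in> R \<Longrightarrow> y \<in> mspace Y"
    and "x \<in> mspace X \<Longrightarrow> \<exists>y. (x, y) \<in> R" "y \<in> mspace Y \<Longrightarrow> \<exists>x. (x, y) \<in> R"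
    and "(x, y) \<in> R \<Longrightarrow> (x', y') \<in> R \<Longrightarrow> \<bar>mdist X x x' - mdist Y y y'\<bar> \<le> 2 * r"
  using assms unfolding correspondence_def by blast+

lemma correspondence_mono:
  assumes R: "correspondence X Y r R" and "r \<le> s" shows "correspondence X Y s R"
proof (rule correspondenceI)
  fix x y x' y' assume "(x, y) \<in> R" "(x', y') \<in> R"
  from correspondenceD(5)[OF R this] \<open>r \<le> s\<close> show "\<bar>mdist X x x' - mdist Y y y'\<bar> \<le> 2 * s"
    by linarith
qed (use correspondenceD[OF R] in blast)+

lemma correspondence_converse:
  assumes R: "correspondence X Y r R" shows "correspondence Y X r (R\<inverse>)"
proof (rule correspondenceI)
  fix x y x' y' assume "(x, y) \<in> R\<inverse>" "(x', y') \<in> R\<inverse>"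
  then show "\<bar>mdist Y x x' - mdist X y y'\<bar> \<le> 2 * r"
    using correspondenceD(5)[OF R, of y x y' x'] by (simp add: abs_minus_commute)
qed (use correspondenceD[OF R] in blast)+

lemma correspondence_relcomp:
  assumes R: "correspondence X Y r R" and S: "correspondence Y Z s S"
  shows "correspondence X Z (r + s) (R O S)"
proof (rule correspondenceI)
  fix x z x' z' assume "(x, z) \<in> R O S" "(x', z') \<in> R O S"
  then obtain y y' where "(x, y) \<in> R" "(y, z) \<in> S" "(x', y') \<in> R" "(y', z') \<in> S"
    by blast
  then have "\<bar>mdist X x x' - mdist Y y y'\<bar> \<le> 2 * r" "\<bar>mdist Y y y' - mdist Z z z'\<bar> \<le> 2 * s"
    using correspondenceD(5)[OF R] correspondenceD(5)[OF S] by blast+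
  then show "\<bar>mdist X x x' - mdist Z z z'\<bar> \<le> 2 * (r + s)" by (smt (verit))
next
  fix x assume "x \<in> mspace X"
  then obtain y where "(x, y) \<in> R" using correspondenceD(3)[OF R] by blast
  moreover from this obtain z where "(y, z) \<in> S"
    using correspondenceD(2)[OF R] correspondenceD(3)[OF S] by blast
  ultimately show "\<exists>z. (x, z) \<in> R O S" by blast
next
  fix z assume "z \<in> mspace Z"
  then obtain y where "(y, z) \<in> S" using correspondenceD(4)[OF S] by blast
  moreover from this obtain x where "(x, y) \<in> R"
    using correspondenceD(4)[OF R] correspondenceD(1)[OF S] by blast
  ultimately show "\<exists>x. (x, z) \<in> R O S" by blast
qed (use correspondenceD(1)[OF R] correspondenceD(2)[OF S] in blast)

lemma correspondence_of_isometric: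
  assumes "isometric X Y" shows "\<exists>R. correspondence X Y 0 R"
proof -
  obtain f where f: "isometric_embedding X Y f" "f ` mspace X = mspace Y"
    using assms unfolding isometric_def by blast
  have "correspondence X Y 0 ((\<lambda>x. (x, f x)) ` mspace X)"
    using f by (intro correspondenceI) (auto simp: isometric_embedding_def set_eq_iff image_iff)
  then show ?thesis ..
qed

text \<open>The distortion of the total relation is bounded by the diameters. Gluing along it
  supplies a first common ambient space, so that the infimum in \<open>GH\<close> is not over the
  empty set.\<close>

lemma correspondence_all:
  assumes "nonempty_compact_metric X" "nonempty_compact_metric Y"
  shows "\<exists>r>0. correspondence X Y r (mspace X \<times> mspace Y)"
proof -
  obtain x B where x: "x \<in> mspace X" "\<And>y. y \<in> mspace X \<Longrightarrow> mdist X x y \<le> B"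
    using mbounded_of_compact[OF assms(1)] by blast
  obtain y C where y: "y \<in> mspace Y" "\<And>z. z \<in> mspace Y \<Longrightarrow> mdist Y y z \<le> C"
    using mbounded_of_compact[OF assms(2)] by blast
  have B: "0 \<le> mdist X p q" "mdist X p q \<le> 2 * B" if "p \<in> mspace X" "q \<in> mspace X" for p q
    using mdist_triangle[OF that(1) x(1) that(2)] x(2)[OF that(1)] x(2)[OF that(2)]
    by (auto simp: mdist_commute)
  have C: "0 \<le> mdist Y p q" "mdist Y p q \<le> 2 * C" if "p \<in> mspace Y" "q \<in> mspace Y" for p q
    using mdist_triangle[OF that(1) y(1) that(2)] y(2)[OF that(1)] y(2)[OF that(2)]
    by (auto simp: mdist_commute)
  have "0 \<le> B" "0 \<le> C" using B[OF x(1) x(1)] C[OF y(1) y(1)] by linarith+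
  moreover have "correspondence X Y (B + C + 1) (mspace X \<times> mspace Y)"
  proof (rule correspondenceI)
    fix p q p' q' assume "(p, q) \<in> mspace X \<times> mspace Y" "(p', q') \<in> mspace X \<times> mspace Y"
    then have "0 \<le> mdist X p p'" "mdist X p p' \<le> 2 * B" "0 \<le> mdist Y q q'" "mdist Y q q' \<le> 2 * C"
      using B C by auto
    then show "\<bar>mdist X p p' - mdist Y q q'\<bar> \<le> 2 * (B + C + 1)"
      using \<open>0 \<le> B\<close> \<open>0 \<le> C\<close> by (smt (verit))
  qed (use x(1) y(1) in auto)
  ultimately show ?thesis by (intro exI[of _ "B + C + 1"]) auto
qed

text \<open>The distance between points of different spaces is the infimal length of a route that
  crosses once, along an edge of \<open>R\<close> of length \<open>r\<close>. The distortion bound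
  prevents shortcuts by crossing back and forth, and \<open>0 < r\<close> keeps distinct points at
  positive distance.\<close>

lemma glue_along_correspondence:
  assumes R: "correspondence X Y r R" and "0 < r" and "mspace X \<noteq> {}"
  obtains Z :: "('a + 'b) metric" where
    "isometric_embedding (X :: 'a metric) Z Inl" "isometric_embedding (Y :: 'b metric) Z Inr"
    "\<And>x y. (x, y) \<in> R \<Longrightarrow> mdist Z (Inl x) (Inr y) \<le> r"
proof -
  define g where "g x y = (\<lambda>(x', y'). mdist X x x' + mdist Y y y' + r)" for x y
  define h where "h x y = (INF p\<in>R. g x y p)" for x y
  have ne: "R \<noteq> {}" using correspondenceD(3)[OF R] assms(3) by blast
  have bdd: "bdd_below (g x y ` R)" for x y
    by (rule bdd_belowI[of _ r]) (auto simp: g_def)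
  have h_le: "h x y \<le> mdist X x x' + mdist Y y y' + r" if "(x', y') \<in> R" for x y x' y'
    using cINF_lower[OF bdd that, of x y] by (simp add: h_def g_def)
  have h_ge: "c \<le> h x y" if "\<And>x' y'. (x', y') \<in> R \<Longrightarrow> c \<le> mdist X x x' + mdist Y y y' + r" for c x y
    unfolding h_def by (rule cINF_greatest[OF ne]) (use that in \<open>auto simp: g_def\<close>)
  have h_pos: "r \<le> h x y" for x y by (rule h_ge) simp
  have RX: "x \<in> mspace X" "y \<in> mspace Y" if "(x, y) \<in> R" for x y
    using correspondenceD(1,2)[OF R] that by blast+
  have dis: "\<bar>mdist X x x' - mdist Y y y'\<bar> \<le> 2 * r" if "(x, y) \<in> R" "(x', y') \<in> R" for x y x' y'
    using correspondenceD(5)[OF R] that .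
  have h_X: "h x y \<le> mdist X x x' + h x' y" if "x \<in> mspace X" "x' \<in> mspace X" for x x' y
  proof -
    have "h x y - mdist X x x' \<le> h x' y"
    proof (rule h_ge)
      fix u v assume uv: "(u, v) \<in> R"
      show "h x y - mdist X x x' \<le> mdist X x' u + mdist Y y v + r"
        using h_le[OF uv, of x y] mdist_triangle[OF that(1,2) RX(1)[OF uv]] by linarith
    qed
    then show ?thesis by linarith
  qed
  have h_Y: "h x y \<le> h x y' + mdist Y y' y" if "y \<in> mspace Y" "y' \<in> mspace Y" for x y y'
  proof -
    have "h x y - mdist Y y' y \<le> h x y'"
    proof (rule h_ge)
      fix u v assume uv: "(u, v) \<in> R"
      show "h x y - mdist Y y' y \<le> mdist X x u + mdist Y y' v + r"
        using h_le[OF uv, of x y] mdist_triangle[OF that(1,2) RX(2)[OF uv]]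
        by (simp add: mdist_commute)
    qed
    then show ?thesis by linarith
  qed
  have h_X': "h x y \<le> h x' y + mdist X x' x" if "x \<in> mspace X" "x' \<in> mspace X" for x x' y
    using h_X[OF that, of y] by (simp add: mdist_commute)
  have h_Y': "h x y \<le> mdist Y y y' + h x y'" if "y \<in> mspace Y" "y' \<in> mspace Y" for x y y'
    using h_Y[OF that, of x] by (simp add: mdist_commute)
  \<comment> \<open>Crossing at \<open>(u, v)\<close> and returning at \<open>(u', v')\<close> costs
    \<open>2 * r\<close> plus the distance of \<open>v\<close> and \<open>v'\<close>, which is at
    least the distance of \<open>u\<close> and \<open>u'\<close>.\<close>
  have X_h: "mdist X x x' \<le> h x y + h x' y" if "x \<in> mspace X" "x' \<in> mspace X" "y \<in> mspace Y" for x x' y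
  proof -
    have "mdist X x x' - h x' y \<le> h x y"
    proof (rule h_ge)
      fix u v assume uv: "(u, v) \<in> R"
      have "mdist X x x' - (mdist X x u + mdist Y y v + r) \<le> h x' y"
      proof (rule h_ge)
        fix u' v' assume uv': "(u', v') \<in> R"
        show "mdist X x x' - (mdist X x u + mdist Y y v + r) \<le> mdist X x' u' + mdist Y y v' + r"
          using dis[OF uv uv'] mdist_triangle[OF that(1) RX(1)[OF uv] that(2)]
            mdist_triangle[OF RX(1)[OF uv] RX(1)[OF uv'] that(2)]
            mdist_triangle[OF RX(2)[OF uv] that(3) RX(2)[OF uv']]
          by (simp add: mdist_commute)
      qed
      then show "mdist X x x' - h x' y \<le> mdist X x u + mdist Y y v + r" by linarith
    qed
    then show ?thesis by linarith
  qed
  have Y_h: "mdist Y y y' \<le> h x y + h x y'" if "y \<in> mspace Y" "y' \<in> mspace Y" "x \<in> mspace X" for x y y'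
  proof -
    have "mdist Y y y' - h x y' \<le> h x y"
    proof (rule h_ge)
      fix u v assume uv: "(u, v) \<in> R"
      have "mdist Y y y' - (mdist X x u + mdist Y y v + r) \<le> h x y'"
      proof (rule h_ge)
        fix u' v' assume uv': "(u', v') \<in> R"
        show "mdist Y y y' - (mdist X x u + mdist Y y v + r) \<le> mdist X x u' + mdist Y y' v' + r"
          using dis[OF uv uv'] mdist_triangle[OF that(1) RX(2)[OF uv] that(2)]
            mdist_triangle[OF RX(2)[OF uv] RX(2)[OF uv'] that(2)]
            mdist_triangle[OF RX(1)[OF uv] that(3) RX(1)[OF uv']]
          by (simp add: mdist_commute)
      qed
      then show "mdist Y y y' - h x y' \<le> mdist X x u + mdist Y y v + r" by linarith
    qed
    then show ?thesis by linarith
  qed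
  define D where "D = (\<lambda>p q. case (p, q) of
      (Inl x, Inl x') \<Rightarrow> mdist X x x' | (Inr y, Inr y') \<Rightarrow> mdist Y y y'
    | (Inl x, Inr y) \<Rightarrow> h x y | (Inr y, Inl x) \<Rightarrow> h x y)"
  have D_simps [simp]: "D (Inl x) (Inl x') = mdist X x x'" "D (Inr y) (Inr y') = mdist Y y y'"
    "D (Inl x) (Inr y) = h x y" "D (Inr y) (Inl x) = h x y" for x x' y y'
    by (simp_all add: D_def)
  have h0: "0 < h x y" for x y using h_pos[of x y] \<open>0 < r\<close> by linarith
  interpret Z: Metric_space "mspace X <+> mspace Y" D
  proof
    fix p q :: "'a + 'b"
    show "0 \<le> D p q" using h0 by (cases p; cases q) (auto simp: less_imp_le)
    show "D p q = D q p" by (cases p; cases q) (auto simp: mdist_commute)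
    assume "p \<in> mspace X <+> mspace Y" "q \<in> mspace X <+> mspace Y"
    then show "D p q = 0 \<longleftrightarrow> p = q"
      using h0 by (cases p; cases q) (auto simp: less_imp_neq[THEN not_sym])
    fix w assume "w \<in> mspace X <+> mspace Y"
    with \<open>p \<in> _\<close> \<open>q \<in> _\<close> show "D p w \<le> D p q + D q w"
      by (cases p; cases q; cases w)
        (simp_all add: Plus_def image_iff mdist_triangle X_h Y_h h_X h_Y h_X' h_Y')
  qed
  show thesis
  proof (rule that)
    show "isometric_embedding X (metric (mspace X <+> mspace Y, D)) Inl"
      "isometric_embedding Y (metric (mspace X <+> mspace Y, D)) Inr"
      by (auto simp: isometric_embedding_def)
    show "mdist (metric (mspace X <+> mspace Y, D)) (Inl x) (Inr y) \<le> r" if "(x, y) \<in> R" for x y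
      using h_le[OF that, of x y] RX[OF that] by simp
  qed
qed

text \<open>Glue along \<open>R\<close> and compare the two copies. Gluing needs edges of positive
  length while \<open>r\<close> may be \<open>0\<close>, hence the slack \<open>e\<close>.\<close>

lemma GH_le_of_correspondence:
  assumes X: "nonempty_compact_metric X" and Y: "nonempty_compact_metric Y"
    and R: "correspondence X Y r R" and "0 \<le> r"
  shows "GH X Y \<le> r"
proof (rule field_le_epsilon)
  fix e :: real assume "0 < e"
  have R': "correspondence X Y (r + e / 2) R"
    using correspondence_mono[OF R] \<open>0 < e\<close> by simp
  have pos: "0 < r + e / 2" using \<open>0 < e\<close> \<open>0 \<le> r\<close> by linarith
  obtain Z :: "('a + 'b) metric" where Z: "isometric_embedding X Z Inl" "isometric_embedding Y Z Inr"
    "\<And>x y. (x, y) \<in> R \<Longrightarrow> mdist Z (Inl x) (Inr y) \<le> r + e / 2"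
    using glue_along_correspondence[OF R' pos] X by (auto simp: nonempty_compact_metric_def)
  have RX: "x \<in> mspace X" "y \<in> mspace Y" if "(x, y) \<in> R" for x y
    using correspondenceD(1,2)[OF R] that by blast+
  have in_ball: "Inl x \<in> mball_of Z (Inr y) (r + e)" "Inr y \<in> mball_of Z (Inl x) (r + e)"
    if "(x, y) \<in> R" for x y
    using Z(3)[OF that] RX[OF that] Z(1,2) \<open>0 < e\<close>
    by (auto simp: isometric_embedding_def mdist_commute image_subset_iff)
  have 1: "Inl ` mspace X \<subseteq> (\<Union>b\<in>Inr ` mspace Y. mball_of Z b (r + e))"
  proof (rule image_subsetI)
    fix x assume "x \<in> mspace X"
    then obtain y where y: "(x, y) \<in> R" using correspondenceD(3)[OF R] by blast
    show "Inl x \<in> (\<Union>b\<in>Inr ` mspace Y. mball_of Z b (r + e))"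
      using in_ball(1)[OF y] RX(2)[OF y] by blast
  qed
  have 2: "Inr ` mspace Y \<subseteq> (\<Union>a\<in>Inl ` mspace X. mball_of Z a (r + e))"
  proof (rule image_subsetI)
    fix y assume "y \<in> mspace Y"
    then obtain x where x: "(x, y) \<in> R" using correspondenceD(4)[OF R] by blast
    show "Inr y \<in> (\<Union>a\<in>Inl ` mspace X. mball_of Z a (r + e))"
      using in_ball(2)[OF x] RX(1)[OF x] by blast
  qed
  have "GH X Y \<le> hausdorff_distance Z (Inl ` mspace X) (Inr ` mspace Y)"
    by (rule GH_le_hausdorff_distance[OF X Z(1) Y Z(2)])
  also have "\<dots> \<le> r + e"
    unfolding hausdorff_distance_def using 1 2 \<open>0 < e\<close> \<open>0 \<le> r\<close>
    by (intro cInf_lower) (auto intro!: bdd_belowI[of _ 0])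
  finally show "GH X Y \<le> r + e" .
qed

text \<open>In a nearly optimal ambient space, relate the points whose images are closer than
  \<open>r\<close>; two uses of the triangle inequality bound the distortion by
  \<open>2 * r\<close>.\<close>

lemma correspondence_of_GH_less:
  fixes X :: "'a metric" and Y :: "'b metric"
  assumes X: "nonempty_compact_metric X" and Y: "nonempty_compact_metric Y" and less: "GH X Y < c"
  obtains r R where "0 < r" "r < c" "correspondence X Y r R"
proof -
  obtain r0 where r0: "0 < r0" "correspondence X Y r0 (mspace X \<times> mspace Y)"
    using correspondence_all[OF X Y] by blast
  obtain x0 y0 where xy0: "x0 \<in> mspace X" "y0 \<in> mspace Y"
    using X Y by (auto simp: nonempty_compact_metric_def)
  let ?S = "{hausdorff_distance Z (i ` mspace X) (j ` mspace Y) | (Z :: ('a + 'b) metric) i j.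
               isometric_embedding X Z i \<and> isometric_embedding Y Z j}"
  obtain Z0 :: "('a + 'b) metric" where "isometric_embedding X Z0 Inl" "isometric_embedding Y Z0 Inr"
    using xy0(1) by (blast intro: glue_along_correspondence[OF r0(2,1)])
  \<comment> \<open>An infimum below \<open>c\<close> yields an element below \<open>c\<close> only
    for a non-empty set. The radii \<open>?T\<close> get the same treatment, using boundedness of
    both spaces.\<close>
  then have "?S \<noteq> {}" by blast
  with less obtain h where "h \<in> ?S" "h < c"
    unfolding GH_def by (meson cInf_lessD)
  then obtain Z :: "('a + 'b) metric" and i j where
    Z: "isometric_embedding X Z i" "isometric_embedding Y Z j"
      "hausdorff_distance Z (i ` mspace X) (j ` mspace Y) < c"
    by blast
  have iX: "i x \<in> mspace Z" "mdist Z (i x) (i x') = mdist X x x'"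
    if "x \<in> mspace X" "x' \<in> mspace X" for x x'
    using Z(1) that by (auto simp: isometric_embedding_def)
  have jY: "j y \<in> mspace Z" "mdist Z (j y) (j y') = mdist Y y y'"
    if "y \<in> mspace Y" "y' \<in> mspace Y" for y y'
    using Z(2) that by (auto simp: isometric_embedding_def)
  let ?T = "{r. 0 < r \<and> i ` mspace X \<subseteq> (\<Union>b\<in>j ` mspace Y. mball_of Z b r) \<and>
                  j ` mspace Y \<subseteq> (\<Union>a\<in>i ` mspace X. mball_of Z a r)}"
  have "?T \<noteq> {}"
  proof -
    obtain x B where x: "x \<in> mspace X" "\<And>y. y \<in> mspace X \<Longrightarrow> mdist X x y \<le> B"
      using mbounded_of_compact[OF X] by blast
    obtain y C where y: "y \<in> mspace Y" "\<And>z. z \<in> mspace Y \<Longrightarrow> mdist Y y z \<le> C"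
      using mbounded_of_compact[OF Y] by blast
    define r where "r = \<bar>B\<bar> + \<bar>C\<bar> + mdist Z (i x) (j y) + 1"
    have "0 < r" unfolding r_def using mdist_nonneg[of Z "i x" "j y"] by linarith
    have "mdist Z (j y) (i z) < r" if "z \<in> mspace X" for z
      using mdist_triangle[OF jY(1)[OF y(1) y(1)] iX(1)[OF x(1) x(1)] iX(1)[OF that that]]
        iX(2)[OF x(1) that] x(2)[OF that] by (simp add: r_def mdist_commute)
    moreover have "mdist Z (i x) (j z) < r" if "z \<in> mspace Y" for z
      using mdist_triangle[OF iX(1)[OF x(1) x(1)] jY(1)[OF y(1) y(1)] jY(1)[OF that that]]
        jY(2)[OF y(1) that] y(2)[OF that] by (simp add: r_def)
    ultimately have "i ` mspace X \<subseteq> mball_of Z (j y) r" "j ` mspace Y \<subseteq> mball_of Z (i x) r"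
      using iX(1) jY(1) x(1) y(1) by auto
    then have "r \<in> ?T" using \<open>0 < r\<close> x(1) y(1) by blast
    then show ?thesis by blast
  qed
  then obtain r where "r \<in> ?T" and "r < c"
    using Z(3) unfolding hausdorff_distance_def by (meson cInf_lessD)
  then have r: "0 < r" "i ` mspace X \<subseteq> (\<Union>b\<in>j ` mspace Y. mball_of Z b r)"
    "j ` mspace Y \<subseteq> (\<Union>a\<in>i ` mspace X. mball_of Z a r)"
    by simp_all
  define R where "R = {(x, y). x \<in> mspace X \<and> y \<in> mspace Y \<and> mdist Z (i x) (j y) < r}"
  have "correspondence X Y r R"
  proof (rule correspondenceI)
    fix x assume "x \<in> mspace X"
    then obtain y where "y \<in> mspace Y" "i x \<in> mball_of Z (j y) r" using r(2) by blast
    then show "\<exists>y. (x, y) \<in> R" using \<open>x \<in> mspace X\<close> by (auto simp: R_def mdist_commute)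
  next
    fix y assume "y \<in> mspace Y"
    then obtain x where "x \<in> mspace X" "j y \<in> mball_of Z (i x) r" using r(3) by blast
    then show "\<exists>x. (x, y) \<in> R" using \<open>y \<in> mspace Y\<close> by (auto simp: R_def)
  next
    fix x y x' y' assume "(x, y) \<in> R" "(x', y') \<in> R"
    then have m: "x \<in> mspace X" "y \<in> mspace Y" "x' \<in> mspace X" "y' \<in> mspace Y"
      and d: "mdist Z (i x) (j y) < r" "mdist Z (i x') (j y') < r"
      by (auto simp: R_def)
    note Zs = iX(1)[OF m(1) m(1)] iX(1)[OF m(3) m(3)] jY(1)[OF m(2) m(2)] jY(1)[OF m(4) m(4)]
    have "mdist X x x' \<le> mdist Z (i x) (j y) + (mdist Y y y' + mdist Z (i x') (j y'))"
      using mdist_triangle[OF Zs(1,3,2)] mdist_triangle[OF Zs(3,4,2)] iX(2)[OF m(1,3)] jY(2)[OF m(2,4)]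
      by (simp add: mdist_commute)
    moreover have "mdist Y y y' \<le> mdist Z (i x) (j y) + (mdist X x x' + mdist Z (i x') (j y'))"
      using mdist_triangle[OF Zs(3,1,4)] mdist_triangle[OF Zs(1,2,4)] iX(2)[OF m(1,3)] jY(2)[OF m(2,4)]
      by (simp add: mdist_commute)
    ultimately show "\<bar>mdist X x x' - mdist Y y y'\<bar> \<le> 2 * r" using d by (smt (verit))
  qed (auto simp: R_def)
  then show thesis using that r(1) \<open>r < c\<close> by blast
qed

section \<open>Metric axioms for the Gromov-Hausdorff distance\<close>

lemma GH_nonneg:
  assumes X: "nonempty_compact_metric X" and Y: "nonempty_compact_metric Y"
  shows "0 \<le> GH X Y"
proof (rule ccontr)
  assume "\<not> 0 \<le> GH X Y"
  then have "GH X Y < 0" by simp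
  then show False by (rule correspondence_of_GH_less[OF X Y]) simp
qed

lemma GH_commute_le:
  assumes X: "nonempty_compact_metric X" and Y: "nonempty_compact_metric Y"
  shows "GH X Y \<le> GH Y X"
proof (rule field_le_epsilon)
  fix e :: real assume "0 < e"
  then have "GH Y X < GH Y X + e" by simp
  then obtain r R where r: "0 < r" "r < GH Y X + e" "correspondence Y X r R"
    by (rule correspondence_of_GH_less[OF Y X])
  then show "GH X Y \<le> GH Y X + e"
    using GH_le_of_correspondence[OF X Y correspondence_converse[OF r(3)]] by linarith
qed

lemma GH_triangle:
  assumes X: "nonempty_compact_metric X" and Y: "nonempty_compact_metric Y"
    and Z: "nonempty_compact_metric Z"
  shows "GH X Z \<le> GH X Y + GH Y Z"
proof (rule field_le_epsilon)
  fix e :: real assume "0 < e"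
  then have "GH X Y < GH X Y + e / 2" by simp
  then obtain r R where r: "0 < r" "r < GH X Y + e / 2" "correspondence X Y r R"
    by (rule correspondence_of_GH_less[OF X Y])
  have "GH Y Z < GH Y Z + e / 2" using \<open>0 < e\<close> by simp
  then obtain s S where s: "0 < s" "s < GH Y Z + e / 2" "correspondence Y Z s S"
    by (rule correspondence_of_GH_less[OF Y Z])
  have "GH X Z \<le> r + s"
    using GH_le_of_correspondence[OF X Z correspondence_relcomp[OF r(3) s(3)]] r(1) s(1) by simp
  with r(2) s(2) show "GH X Z \<le> GH X Y + GH Y Z + e" by linarith
qed

text \<open>The maps that distort distances by at most \<open>1 / Suc n\<close> form a decreasing sequence of
  non-empty closed subsets of \<open>Y\<^sup>X\<close>, which is compact by Tychonoff's theorem.\<close>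

lemma isometric_embedding_of_GH_eq_0:
  assumes X: "nonempty_compact_metric X" and Y: "nonempty_compact_metric Y" and GH: "GH X Y = 0"
  obtains f where "isometric_embedding X Y f"
proof -
  let ?P = "product_topology (\<lambda>_. mtopology_of Y) (mspace X)"
  define A where "A n x x' = {g \<in> topspace ?P. \<bar>mdist Y (g x) (g x') - mdist X x x'\<bar> \<in> {..1 / real (Suc n)}}"
    for n x x'
  define C where "C n = topspace ?P \<inter> (\<Inter>x\<in>mspace X. \<Inter>x'\<in>mspace X. A n x x')" for n
  have "compact_space ?P"
    using Y by (simp add: compact_space_product_topology nonempty_compact_metric_def)
  moreover have "closedin ?P (C n)" for n
  proof -
    have "closedin ?P (A n x x')" if "x \<in> mspace X" "x' \<in> mspace X" for x x'
    proof -
      have "continuous_map ?P euclidean (\<lambda>g. mdist Y (g x) (g x'))"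
        by (intro continuous_map_mdist continuous_map_product_projection that)
      then have "continuous_map ?P euclideanreal (\<lambda>g. \<bar>mdist Y (g x) (g x') - mdist X x x'\<bar>)"
        by (intro continuous_map_real_abs continuous_map_diff) auto
      then show ?thesis
        unfolding A_def by (rule closedin_continuous_map_preimage) simp
    qed
    then show ?thesis
      using X unfolding C_def
      by (intro closedin_Int closedin_Inter closedin_topspace)
        (auto simp: nonempty_compact_metric_def intro!: closedin_Inter)
  qed
  moreover have "C n \<noteq> {}" for n
  proof -
    \<comment> \<open>Half of \<open>1 / Suc n\<close>, because a correspondence with bound
      \<open>r\<close> distorts distances by up to \<open>2 * r\<close>.\<close>
    have "GH X Y < 1 / (2 * real (Suc n))" using GH by simp
    then obtain r R where r: "0 < r" "r < 1 / (2 * real (Suc n))" "correspondence X Y r R"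
      by (rule correspondence_of_GH_less[OF X Y])
    then obtain f where f: "\<And>x. x \<in> mspace X \<Longrightarrow> (x, f x) \<in> R"
      using correspondenceD(3)[OF r(3)] by metis
    have "2 * r \<le> 1 / real (Suc n)" using r(2) by (simp add: field_simps)
    \<comment> \<open>Points of the product space are extensional functions, hence
      \<open>restrict\<close>.\<close>
    then have "restrict f (mspace X) \<in> C n"
      using correspondenceD(2)[OF r(3) f] correspondenceD(5)[OF r(3) f f]
      by (fastforce simp: C_def A_def abs_minus_commute topspace_product_topology)
    then show ?thesis by blast
  qed
  moreover have "decseq C"
  proof (rule decseq_SucI)
    fix n
    have "1 / real (Suc (Suc n)) \<le> 1 / real (Suc n)" by (simp add: field_simps)
    then show "C (Suc n) \<subseteq> C n"
      unfolding C_def A_def by fastforce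
  qed
  ultimately have "(\<Inter>n. C n) \<noteq> {}" by (rule compact_space_imp_nest)
  then obtain g where g: "\<And>n. g \<in> C n" by auto
  have "g \<in> topspace ?P" using g[of 0] by (simp add: C_def)
  then have "g ` mspace X \<subseteq> mspace Y" by (auto simp: topspace_product_topology)
  moreover have "mdist Y (g x) (g x') = mdist X x x'" if "x \<in> mspace X" "x' \<in> mspace X" for x x'
  proof -
    have le: "\<bar>mdist Y (g x) (g x') - mdist X x x'\<bar> \<le> 1 / real (Suc n)" for n
      using g[of n] that by (simp add: C_def A_def)
    have "\<bar>mdist Y (g x) (g x') - mdist X x x'\<bar> \<le> 0"
    proof (rule field_le_epsilon)
      fix e :: real assume "0 < e"
      then obtain n where "1 / real (Suc n) < e" by (rule nat_approx_posE)
      with le[of n] show "\<bar>mdist Y (g x) (g x') - mdist X x x'\<bar> \<le> 0 + e" by linarith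
    qed
    then show ?thesis by simp
  qed
  ultimately show thesis by (intro that[of g]) (simp add: isometric_embedding_def)
qed

text \<open>There are embeddings \<open>f\<close> and \<open>g\<close> in both directions. Their
  composite is a self-embedding of the compact space \<open>Y\<close>, hence onto, and so
  \<open>f\<close> is onto.\<close>

lemma isometric_of_GH_eq_0:
  assumes X: "nonempty_compact_metric X" and Y: "nonempty_compact_metric Y" and GH: "GH X Y = 0"
  shows "isometric X Y"
proof -
  have "GH Y X = 0"
    using GH_commute_le[OF X Y] GH_commute_le[OF Y X] GH by simp
  then obtain f g where f: "isometric_embedding X Y f" and g: "isometric_embedding Y X g"
    using isometric_embedding_of_GH_eq_0 X Y GH by metis
  have "(f \<circ> g) ` mspace Y = mspace Y"
    by (rule isometric_self_embedding_surj[OF Y isometric_embedding_comp[OF g f]])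
  moreover have "g ` mspace Y \<subseteq> mspace X" "f ` mspace X \<subseteq> mspace Y"
    using f g by (auto simp: isometric_embedding_def)
  ultimately have "f ` mspace X = mspace Y" unfolding image_comp[symmetric] by blast
  with f show ?thesis unfolding isometric_def by blast
qed

section \<open>The Gromov-Hausdorff space as a metric space\<close>

lemma gh_space_cases:
  obtains X where "nonempty_compact_metric X" "p = abs_gh_space X"
proof -
  have "isometric_compact (rep_gh_space p) (rep_gh_space p)"
    using Quotient3_rep_reflp[OF Quotient3_gh_space] .
  then show thesis
    using that Quotient3_abs_rep[OF Quotient3_gh_space, of p] by (metis isometric_compact_def)
qed

lemma isometric_compact_refl: "nonempty_compact_metric X \<Longrightarrow> isometric_compact X X"
  by (simp add: isometric_compact_def isometric_refl)

lemma gh_dist_abs: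
  assumes "nonempty_compact_metric X" "nonempty_compact_metric Y"
  shows "gh_dist (abs_gh_space X) (abs_gh_space Y) = GH X Y"
  using assms by (simp add: gh_dist.abs_eq isometric_compact_refl)

lemma is_metric_tree_abs:
  assumes "nonempty_compact_metric X"
  shows "is_metric_tree (abs_gh_space X) \<longleftrightarrow> metric_tree X"
  using assms by (simp add: is_metric_tree.abs_eq isometric_compact_refl)

lemma abs_gh_space_eq_iff:
  assumes "nonempty_compact_metric X" "nonempty_compact_metric Y"
  shows "abs_gh_space X = abs_gh_space Y \<longleftrightarrow> isometric X Y"
  using assms Quotient3_rel[OF Quotient3_gh_space, of X Y]
  by (auto simp: isometric_compact_def isometric_refl)

lemma Metric_space_gh_dist: "Metric_space UNIV gh_dist"
proof
  fix p q s
  obtain X where X: "nonempty_compact_metric X" "p = abs_gh_space X" by (rule gh_space_cases)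
  obtain Y where Y: "nonempty_compact_metric Y" "q = abs_gh_space Y" by (rule gh_space_cases)
  obtain Z where Z: "nonempty_compact_metric Z" "s = abs_gh_space Z" by (rule gh_space_cases)
  show "0 \<le> gh_dist p q" using X Y by (simp add: gh_dist_abs GH_nonneg)
  show "gh_dist p q = gh_dist q p"
    using X Y by (simp add: gh_dist_abs GH_commute_le antisym)
  show "gh_dist p s \<le> gh_dist p q + gh_dist q s"
    using X Y Z by (simp add: gh_dist_abs GH_triangle)
  show "gh_dist p q = 0 \<longleftrightarrow> p = q"
  proof
    assume "gh_dist p q = 0"
    then show "p = q"
      using X Y isometric_of_GH_eq_0[of X Y] by (simp add: gh_dist_abs abs_gh_space_eq_iff)
  next
    assume "p = q"
    obtain R where "correspondence X X 0 R"
      using correspondence_of_isometric[OF isometric_refl] by blast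
    then have "GH X X \<le> 0" by (intro GH_le_of_correspondence X(1)) auto
    then show "gh_dist p q = 0"
      using X GH_nonneg[OF X(1) X(1)] \<open>p = q\<close> by (simp add: gh_dist_abs)
  qed
qed


section \<open>Metric trees and the Gromov product\<close>

text \<open>Normal form of a geodesic: unit speed, starting at time \<open>0\<close>. Two geodesics
  issuing from the same point can then be compared time by time.\<close>

definition geodesic_path :: "'a metric \<Rightarrow> 'a \<Rightarrow> 'a \<Rightarrow> (real \<Rightarrow> 'a) \<Rightarrow> bool" where
  "geodesic_path X x y f \<longleftrightarrow> f 0 = x \<and> f (mdist X x y) = y \<and> f ` {0..mdist X x y} \<subseteq> mspace X \<and>
     (\<forall>s\<in>{0..mdist X x y}. \<forall>t\<in>{0..mdist X x y}. mdist X (f s) (f t) = \<bar>s - t\<bar>)"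

lemma geodesic_pathD:
  assumes "geodesic_path X x y f"
  shows "f 0 = x" "f (mdist X x y) = y"
    and "0 \<le> s \<Longrightarrow> s \<le> mdist X x y \<Longrightarrow> f s \<in> mspace X"
    and "0 \<le> s \<Longrightarrow> s \<le> mdist X x y \<Longrightarrow> 0 \<le> t \<Longrightarrow> t \<le> mdist X x y \<Longrightarrow> mdist X (f s) (f t) = \<bar>s - t\<bar>"
    and "x \<in> mspace X" "y \<in> mspace X"
proof -
  show f: "f 0 = x" "f (mdist X x y) = y"
    and "0 \<le> s \<Longrightarrow> s \<le> mdist X x y \<Longrightarrow> f s \<in> mspace X" for s
    using assms by (auto simp: geodesic_path_def)
  from this(3)[of 0] this(3)[of "mdist X x y"] f show "x \<in> mspace X" "y \<in> mspace X" by auto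
  show "0 \<le> s \<Longrightarrow> s \<le> mdist X x y \<Longrightarrow> 0 \<le> t \<Longrightarrow> t \<le> mdist X x y \<Longrightarrow> mdist X (f s) (f t) = \<bar>s - t\<bar>"
    using assms by (auto simp: geodesic_path_def)
qed

lemma geodesic_pathI:
  assumes "mdist X x y = l" "f 0 = x" "f l = y"
    and "\<And>s. 0 \<le> s \<Longrightarrow> s \<le> l \<Longrightarrow> f s \<in> mspace X"
    and "\<And>s t. 0 \<le> s \<Longrightarrow> s \<le> t \<Longrightarrow> t \<le> l \<Longrightarrow> mdist X (f s) (f t) = t - s"
  shows "geodesic_path X x y f"
proof -
  have "mdist X (f s) (f t) = \<bar>s - t\<bar>" if "0 \<le> s" "s \<le> l" "0 \<le> t" "t \<le> l" for s t
    using assms(5)[of s t] assms(5)[of t s] that mdist_commute[of X "f s" "f t"]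
    by (cases "s \<le> t") auto
  then show ?thesis
    using assms by (auto simp: geodesic_path_def)
qed

lemma geodesic_segment_iff_path:
  "geodesic_segment X x y S \<longleftrightarrow> (\<exists>f. geodesic_path X x y f \<and> S = f ` {0..mdist X x y})"
proof
  assume "geodesic_segment X x y S"
  then obtain a b :: real and f where f: "a \<le> b"
    "isometric_embedding (submetric euclidean_metric {a..b}) X f" "f a = x" "f b = y" "S = f ` {a..b}"
    unfolding geodesic_segment_def by blast
  have d: "mdist X (f s) (f t) = \<bar>s - t\<bar>" "f s \<in> mspace X"
    if "a \<le> s" "s \<le> b" "a \<le> t" "t \<le> b" for s t
    using f(2) that by (auto simp: isometric_embedding_def dist_real_def)
  have l: "mdist X x y = b - a" using d(1)[of a b] f(1,3,4) by auto
  have "geodesic_path X x y (\<lambda>s. f (a + s))"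
    by (rule geodesic_pathI[OF l]) (use f d(1) d(2)[OF _ _ order_refl f(1)] in auto)
  moreover have "S = (\<lambda>s. f (a + s)) ` {0..mdist X x y}"
    using image_add_atLeastAtMost[of a 0 "b - a"] unfolding f(5) l by (simp add: image_image[of f "(+) a", symmetric])
  ultimately show "\<exists>f. geodesic_path X x y f \<and> S = f ` {0..mdist X x y}" by blast
next
  assume "\<exists>f. geodesic_path X x y f \<and> S = f ` {0..mdist X x y}"
  then obtain f where f: "geodesic_path X x y f" "S = f ` {0..mdist X x y}" by blast
  show "geodesic_segment X x y S"
    unfolding geodesic_segment_def
    by (rule exI[of _ 0], rule exI[of _ "mdist X x y"], rule exI[of _ f])
      (use f in \<open>auto simp: geodesic_path_def isometric_embedding_def dist_real_def\<close>)
qed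

lemma geodesic_path_sub:
  assumes f: "geodesic_path X x y f" and st: "0 \<le> s" "s \<le> t" "t \<le> mdist X x y"
  shows "geodesic_path X (f s) (f t) (\<lambda>u. f (s + u))"
  by (rule geodesic_pathI[where l = "t - s"]) (use geodesic_pathD(3,4)[OF f] st in auto)

lemma geodesic_segment_sub:
  assumes f: "geodesic_path X x y f" and st: "0 \<le> s" "s \<le> t" "t \<le> mdist X x y"
  shows "geodesic_segment X (f s) (f t) (f ` {s..t})"
proof -
  have "mdist X (f s) (f t) = t - s" using geodesic_pathD(4)[OF f, of s t] st by auto
  moreover have "f ` {s..t} = (\<lambda>u. f (s + u)) ` {0..t - s}"
    using image_add_atLeastAtMost[of s 0 "t - s"] by (simp add: image_image[of f "(+) s", symmetric])
  ultimately show ?thesis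
    unfolding geodesic_segment_iff_path using geodesic_path_sub[OF assms] by auto
qed

lemma geodesic_segment_commute:
  assumes "geodesic_segment X x y S" shows "geodesic_segment X y x S"
proof -
  obtain f where f: "geodesic_path X x y f" "S = f ` {0..mdist X x y}"
    using assms unfolding geodesic_segment_iff_path by blast
  have "geodesic_path X y x (\<lambda>s. f (mdist X x y - s))"
    by (rule geodesic_pathI[OF mdist_commute]) (use geodesic_pathD[OF f(1)] in auto)
  moreover have "S = (\<lambda>s. f (mdist X x y - s)) ` {0..mdist X y x}"
    unfolding f(2) image_image[of f "\<lambda>s. mdist X x y - s", symmetric]
    by (simp add: image_diff_atLeastAtMost mdist_commute)
  ultimately show ?thesis unfolding geodesic_segment_iff_path by blast
qed

lemma geodesic_segment_between:
  assumes "geodesic_segment X x y S" "w \<in> S"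
  shows "mdist X x y = mdist X x w + mdist X w y"
proof -
  obtain f where f: "geodesic_path X x y f" "S = f ` {0..mdist X x y}"
    using assms unfolding geodesic_segment_iff_path by blast
  then obtain s where s: "0 \<le> s" "s \<le> mdist X x y" "w = f s" using assms(2) by auto
  show ?thesis
    using geodesic_pathD(4)[OF f(1), of 0 s] geodesic_pathD(4)[OF f(1), of s "mdist X x y"] s
      geodesic_pathD(1,2)[OF f(1)] by simp
qed

lemma geodesic_segment_Un:
  assumes G1: "geodesic_segment X x y G1" and G2: "geodesic_segment X y z G2"
    and d: "mdist X x z = mdist X x y + mdist X y z"
  shows "geodesic_segment X x z (G1 \<union> G2)"
proof -
  obtain f where f: "geodesic_path X x y f" "G1 = f ` {0..mdist X x y}"
    using G1 unfolding geodesic_segment_iff_path by blast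
  obtain g where g: "geodesic_path X y z g" "G2 = g ` {0..mdist X y z}"
    using G2 unfolding geodesic_segment_iff_path by blast
  define a b where "a = mdist X x y" and "b = mdist X y z"
  note fD = geodesic_pathD[OF f(1), folded a_def] and gD = geodesic_pathD[OF g(1), folded b_def]
  have ab: "0 \<le> a" "0 \<le> b" by (simp_all add: a_def b_def)
  define h where "h = (\<lambda>u. if u \<le> a then f u else g (u - a))"
  have hg: "h u = g (u - a)" if "a \<le> u" for u
    using that fD(2) gD(1) by (cases "u = a") (auto simp: h_def)
  \<comment> \<open>At most this by passing through \<open>y\<close>; at least this, since otherwise
    the route from \<open>x\<close> via \<open>f s\<close> and \<open>g t\<close> to
    \<open>z\<close> would be shorter than \<open>mdist X x z\<close>.\<close>
  have cross: "mdist X (f s) (g t) = a - s + t" if "0 \<le> s" "s \<le> a" "0 \<le> t" "t \<le> b" for s t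
  proof -
    have m: "f s \<in> mspace X" "g t \<in> mspace X" using fD(3) gD(3) that by auto
    have "mdist X x (f s) = s" using fD(4)[of 0 s] fD(1) that ab by auto
    moreover have "mdist X (f s) y = a - s" using fD(4)[of s a] fD(2) that ab by auto
    moreover have "mdist X y (g t) = t" using gD(4)[of 0 t] gD(1) that ab by auto
    moreover have "mdist X (g t) z = b - t" using gD(4)[of t b] gD(2) that ab by auto
    ultimately show ?thesis
      using mdist_triangle[OF m(1) fD(6) m(2)] mdist_triangle[OF fD(5) m(1) gD(6)]
        mdist_triangle[OF m gD(6)] d
      by (simp add: a_def[symmetric] b_def[symmetric])
  qed
  have "geodesic_path X x z h"
  proof (rule geodesic_pathI)
    show "mdist X x z = a + b" using d by (simp add: a_def b_def)
    show "h 0 = x" using ab fD(1) by (simp add: h_def)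
    show "h (a + b) = z" using hg[of "a + b"] ab gD(2) by simp
    show "h s \<in> mspace X" if "0 \<le> s" "s \<le> a + b" for s
      using that fD(3)[of s] gD(3)[of "s - a"] by (auto simp: h_def)
    show "mdist X (h s) (h t) = t - s" if st: "0 \<le> s" "s \<le> t" "t \<le> a + b" for s t
    proof (cases "t \<le> a")
      case True
      then show ?thesis using st fD(4)[of s t] by (simp add: h_def)
    next
      case False
      show ?thesis
      proof (cases "s \<le> a")
        case True
        then show ?thesis using False st cross[of s "t - a"] by (simp add: h_def)
      next
        case False
        then show ?thesis using st gD(4)[of "s - a" "t - a"] by (simp add: h_def)
      qed
    qed
  qed
  moreover have "G1 \<union> G2 = h ` {0..mdist X x z}"
  proof -
    have "{0..a + b} = {0..a} \<union> (+) a ` {0..b}" using ab by (auto simp: image_add_atLeastAtMost)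
    then have "h ` {0..a + b} = h ` {0..a} \<union> (\<lambda>u. h (a + u)) ` {0..b}"
      by (simp only: image_Un image_image)
    also have "h ` {0..a} = f ` {0..a}" by (rule image_cong) (auto simp: h_def)
    also have "(\<lambda>u. h (a + u)) ` {0..b} = g ` {0..b}" by (rule image_cong) (auto simp: hg)
    finally show ?thesis using f(2) g(2) d by (simp add: a_def b_def)
  qed
  ultimately show ?thesis unfolding geodesic_segment_iff_path by blast
qed

lemma geodesic_segment_submetric:
  assumes "geodesic_segment X x y S" "S \<subseteq> A"
  shows "geodesic_segment (submetric X A) x y S"
proof -
  obtain f where f: "geodesic_path X x y f" "S = f ` {0..mdist X x y}"
    using assms(1) unfolding geodesic_segment_iff_path by blast
  then have "geodesic_path (submetric X A) x y f"
    using assms(2) by (simp add: geodesic_path_def)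
  with f(2) show ?thesis unfolding geodesic_segment_iff_path by auto
qed

text \<open>In a tree this is the length of the common initial part of the geodesics from
  \<open>p\<close> to \<open>x\<close> and to \<open>y\<close>.\<close>

definition gromov_product :: "'a metric \<Rightarrow> 'a \<Rightarrow> 'a \<Rightarrow> 'a \<Rightarrow> real" where
  "gromov_product X p x y = (mdist X p x + mdist X p y - mdist X x y) / 2"

text \<open>Gromov hyperbolicity with constant 0 at a base point. For geodesic spaces it
  characterises metric trees, and it is easier to verify for glued spaces than the condition on
  segments.\<close>

definition hyperbolic_at :: "'a metric \<Rightarrow> 'a \<Rightarrow> bool" where
  "hyperbolic_at X p \<longleftrightarrow> (\<forall>x\<in>mspace X. \<forall>y\<in>mspace X. \<forall>z\<in>mspace X.
     min (gromov_product X p x y) (gromov_product X p y z) \<le> gromov_product X p x z)"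

lemma gromov_product_commute: "gromov_product X p x y = gromov_product X p y x"
  by (simp add: gromov_product_def mdist_commute[of X x y])

lemma hyperbolic_atD:
  assumes "hyperbolic_at X p" "x \<in> mspace X" "y \<in> mspace X" "z \<in> mspace X"
  shows "min (gromov_product X p x y) (gromov_product X p y z) \<le> gromov_product X p x z"
  using assms by (auto simp: hyperbolic_at_def)

lemma metric_treeD:
  assumes "metric_tree X" "x \<in> mspace X" "y \<in> mspace X" "z \<in> mspace X"
    and "x \<noteq> y" "y \<noteq> z" "x \<noteq> z"
    and "geodesic_segment X x y G1" "geodesic_segment X y z G2" "G1 \<inter> G2 = {y}"
  shows "geodesic_segment X x z (G1 \<union> G2)"
  by (rule assms(1)[unfolded metric_tree_def, THEN conjunct2, rule_format, OF assms(2-)])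

text \<open>Let \<open>T\<close> be the last time at which the two geodesics agree. The tails after
  \<open>T\<close> meet only in \<open>f T\<close>, so the tree condition joins them to a geodesic
  from \<open>x\<close> to \<open>y\<close>, whose length determines the Gromov product.\<close>

lemma metric_tree_branching:
  assumes tree: "metric_tree X" and f: "geodesic_path X p x f" and g: "geodesic_path X p y g"
  obtains t where "0 \<le> t" "t \<le> mdist X p x" "t \<le> mdist X p y" "f t = g t" "gromov_product X p x y = t"
proof -
  define a b where "a = mdist X p x" and "b = mdist X p y"
  note fD = geodesic_pathD[OF f, folded a_def] and gD = geodesic_pathD[OF g, folded b_def]
  have ab: "0 \<le> a" "0 \<le> b" by (simp_all add: a_def b_def)
  define A where "A = {t. 0 \<le> t \<and> t \<le> a \<and> t \<le> b \<and> f t = g t}"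
  define T where "T = Sup A"
  have bdd: "bdd_above A" by (rule bdd_aboveI[of _ a]) (auto simp: A_def)
  have "0 \<in> A" using ab fD(1) gD(1) by (simp add: A_def)
  have T: "0 \<le> T" "T \<le> a" "T \<le> b"
  proof -
    have "A \<noteq> {}" using \<open>0 \<in> A\<close> by blast
    then show "T \<le> a" "T \<le> b" unfolding T_def by (rule cSup_least, simp add: A_def)+
    show "0 \<le> T" unfolding T_def by (rule cSup_upper[OF \<open>0 \<in> A\<close> bdd])
  qed
  \<comment> \<open>The supremum is attained: a gap at time \<open>T\<close> would persist at all
    times closer to \<open>T\<close> than half its size.\<close>
  have eq: "f T = g T"
  proof (rule ccontr)
    assume "f T \<noteq> g T"
    then have e: "0 < mdist X (f T) (g T)" 
      using fD(3)[of T] gD(3)[of T] T mdist_nonneg[of X "f T" "g T"] mdist_zero[of "f T" X "g T"]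
      by linarith
    then have "T - mdist X (f T) (g T) / 2 < Sup A" by (simp add: T_def)
    then obtain t where t: "t \<in> A" "T - mdist X (f T) (g T) / 2 < t"
      using less_cSupD[of A] \<open>0 \<in> A\<close> by blast
    have "t \<le> T" using cSup_upper[OF t(1) bdd] by (simp add: T_def)
    have t': "0 \<le> t" "t \<le> a" "t \<le> b" "f t = g t" using t(1) by (auto simp: A_def)
    have "mdist X (f T) (g T) \<le> mdist X (f T) (f t) + mdist X (g t) (g T)"
      using mdist_triangle[of "f T" X "f t" "g T"] fD(3)[of T] fD(3)[of t] gD(3)[of T] T t' by simp
    then show False
      using fD(4)[of T t] gD(4)[of t T] T t' t(2) \<open>t \<le> T\<close> by simp
  qed
  have "mdist X x y = a + b - 2 * T"
  \<comment> \<open>In this case one tail is a single point. The tree condition asks for distinct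
    points, so the distance is computed directly.\<close>
  proof (cases "T = a \<or> T = b")
    case True
    then show ?thesis
      using fD(2) gD(2) eq gD(4)[of T b] fD(4)[of a T] T ab by auto
  next
    case False
    define w where "w = f T"
    have d: "mdist X x w = a - T" "mdist X w y = b - T"
      using fD(4)[of a T] fD(2) gD(4)[of T b] gD(2) T ab eq by (auto simp: w_def)
    have w: "w \<in> mspace X" using fD(3) T by (simp add: w_def)
    have "geodesic_segment X x w (f ` {T..a})"
      using geodesic_segment_commute[OF geodesic_segment_sub[OF f, of T a]] T fD(2)
      by (simp add: a_def w_def)
    moreover have "geodesic_segment X w y (g ` {T..b})"
      using geodesic_segment_sub[OF g, of T b] T gD(2) eq by (simp add: b_def w_def)
    moreover have "f ` {T..a} \<inter> g ` {T..b} = {w}"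
    proof -
      have sub: "z = w" if z: "z \<in> f ` {T..a}" "z \<in> g ` {T..b}" for z
      proof -
        obtain s where s: "T \<le> s" "s \<le> a" "z = f s" using z(1) by auto
        obtain t where t: "T \<le> t" "t \<le> b" "z = g t" using z(2) by auto
        have "mdist X p z = s" "mdist X p z = t"
          using fD(1) gD(1) fD(4)[of 0 s] gD(4)[of 0 t] s t T ab by auto
        then have "s = t" by simp
        then have "s \<in> A" using s t T unfolding A_def by simp
        then have "s \<le> T" unfolding T_def by (rule cSup_upper[OF _ bdd])
        then show ?thesis using s by (simp add: w_def)
      qed
      have "w \<in> f ` {T..a}" unfolding w_def by (rule imageI) (use T in simp)
      moreover have "w \<in> g ` {T..b}" unfolding w_def eq by (rule imageI) (use T in simp)
      ultimately show ?thesis using sub by blast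
    qed
    moreover have "x \<noteq> w"
    proof
      assume "x = w"
      then have "mdist X x w = 0" using w by (simp only: mdist_self)
      then show False using d(1) False by simp
    qed
    moreover have "w \<noteq> y"
    proof
      assume "w = y"
      then have "mdist X w y = 0" using w by (simp only: mdist_self)
      then show False using d(2) False by simp
    qed
    moreover have "x \<noteq> y"
    proof
      assume "x = y"
      then have "a \<in> A" using fD(2) gD(2) ab by (auto simp: A_def a_def b_def)
      then show False using cSup_upper[OF _ bdd, of a] T False by (simp add: T_def)
    qed
    ultimately have "geodesic_segment X x y (f ` {T..a} \<union> g ` {T..b})"
      by (intro metric_treeD[OF tree fD(6) w gD(6)])
    then have "mdist X x y = mdist X x w + mdist X w y"
      by (rule geodesic_segment_between) (use T in \<open>auto simp: w_def\<close>)
    then show ?thesis using d by simp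
  qed
  then show thesis
    using that[of T] T eq by (simp add: gromov_product_def a_def b_def)
qed

text \<open>The points \<open>f s\<close> and \<open>g t\<close> lie on one geodesic, so their
  Gromov product is \<open>s\<close>. Branching of the paths to these two points therefore happens
  at time \<open>s\<close>.\<close>

lemma metric_tree_paths_agree:
  assumes tree: "metric_tree X" and f: "geodesic_path X p x f" and g: "geodesic_path X p y g"
    and t: "0 \<le> t" "t \<le> mdist X p x" "t \<le> mdist X p y" "f t = g t" and s: "0 \<le> s" "s \<le> t"
  shows "f s = g s"
proof -
  have fs: "geodesic_path X p (f s) f" and gt: "geodesic_path X p (g t) g"
    using geodesic_path_sub[OF f, of 0 s] geodesic_path_sub[OF g, of 0 t] s t
      geodesic_pathD(1)[OF f] geodesic_pathD(1)[OF g] by auto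
  have d: "mdist X p (f s) = s" "mdist X p (g t) = t" "mdist X (f s) (g t) = t - s"
    using geodesic_pathD(1)[OF f] geodesic_pathD(1)[OF g] geodesic_pathD(4)[OF f, of 0 s]
      geodesic_pathD(4)[OF g, of 0 t] geodesic_pathD(4)[OF f, of s t] s t by auto
  obtain u where "f u = g u" "gromov_product X p (f s) (g t) = u"
    using metric_tree_branching[OF tree fs gt] by metis
  then show ?thesis using d by (simp add: gromov_product_def)
qed

text \<open>The geodesics to \<open>x\<close> and \<open>y\<close> agree until time
  \<open>t\<close>, those to \<open>y\<close> and \<open>z\<close> until \<open>u\<close>. Hence
  those to \<open>x\<close> and \<open>z\<close> agree at time \<open>min t u\<close>, and passing
  through that common point bounds the distance of \<open>x\<close> and \<open>z\<close>.\<close>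

lemma metric_tree_imp_hyperbolic_at:
  assumes tree: "metric_tree X" and p: "p \<in> mspace X"
  shows "hyperbolic_at X p"
  unfolding hyperbolic_at_def
proof (intro ballI)
  fix x y z assume xyz: "x \<in> mspace X" "y \<in> mspace X" "z \<in> mspace X"
  have ex: "\<exists>f. geodesic_path X p w f" if w: "w \<in> mspace X" for w
  proof -
    have "geodesic_metric X" using tree[unfolded metric_tree_def] by (rule conjunct1)
    then obtain S where "geodesic_segment X p w S" using p w unfolding geodesic_metric_def by blast
    then show ?thesis unfolding geodesic_segment_iff_path by blast
  qed
  obtain f g h where f: "geodesic_path X p x f" and g: "geodesic_path X p y g"
    and h: "geodesic_path X p z h" using ex[OF xyz(1)] ex[OF xyz(2)] ex[OF xyz(3)] by blast
  obtain t where t: "0 \<le> t" "t \<le> mdist X p x" "t \<le> mdist X p y" "f t = g t"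
    "gromov_product X p x y = t" using metric_tree_branching[OF tree f g] .
  obtain u where u: "0 \<le> u" "u \<le> mdist X p y" "u \<le> mdist X p z" "g u = h u"
    "gromov_product X p y z = u" using metric_tree_branching[OF tree g h] .
  define s where "s = min t u"
  have s: "0 \<le> s" "s \<le> t" "s \<le> u" using t u by (auto simp: s_def)
  have "f s = g s" using metric_tree_paths_agree[OF tree f g t(1-4) s(1,2)] .
  also have "\<dots> = h s" using metric_tree_paths_agree[OF tree g h u(1-4) s(1,3)] .
  finally have eq: "f s = h s" .
  have "mdist X x z \<le> mdist X x (f s) + mdist X (h s) z"
    using mdist_triangle[of x X "f s" z] geodesic_pathD(3)[OF f, of s] xyz s t eq by simp
  also have "\<dots> = mdist X p x - s + (mdist X p z - s)"
    using geodesic_pathD(2)[OF f] geodesic_pathD(4)[OF f, of "mdist X p x" s]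
      geodesic_pathD(2)[OF h] geodesic_pathD(4)[OF h, of s "mdist X p z"] s t u by simp
  finally show "min (gromov_product X p x y) (gromov_product X p y z) \<le> gromov_product X p x z"
    using t(5) u(5) by (simp add: gromov_product_def s_def)
qed

text \<open>Hyperbolicity with constant 0 does not depend on the base point, because it amounts to the
  four-point condition: of the three sums of opposite distances the two largest agree.\<close>

lemma hyperbolic_at_change_base:
  assumes X: "hyperbolic_at X p" and pq: "p \<in> mspace X" "q \<in> mspace X"
  shows "hyperbolic_at X q"
  unfolding hyperbolic_at_def
proof (intro ballI)
  fix x y z assume xyz: "x \<in> mspace X" "y \<in> mspace X" "z \<in> mspace X"
  define a where "a u v = gromov_product X p u v" for u v
  have a: "min (a u v) (a v w) \<le> a u w" if "u \<in> mspace X" "v \<in> mspace X" "w \<in> mspace X" for u v w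
    unfolding a_def by (rule hyperbolic_atD[OF X that])
  have sym: "a u v = a v u" for u v by (simp add: a_def gromov_product_commute)
  have disj: "a x y \<le> a x z \<or> a y z \<le> a x z" "a x q \<le> a x z \<or> a z q \<le> a x z"
    "a x y \<le> a y q \<or> a x q \<le> a y q" "a y z \<le> a y q \<or> a z q \<le> a y q"
    using a[OF xyz] a[OF xyz(1) pq(2) xyz(3)] a[OF xyz(2,1) pq(2)] a[OF xyz(2,3) pq(2)]
    by (simp_all add: min_le_iff_disj sym[of q z] sym[of y x])
  have four_point: "a x y + a z q \<le> a x z + a y q \<or> a y z + a x q \<le> a x z + a y q"
  proof (rule ccontr)
    assume "\<not> ?thesis"
    then have "a x z + a y q < a x y + a z q" "a x z + a y q < a y z + a x q" by simp_all
    with disj show False by (elim disjE) linarith+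
  qed
  \<comment> \<open>After substituting this into the condition at \<open>q\<close>, cancelling
    common terms leaves exactly the two alternatives of \<open>four_point\<close>.\<close>
  have "gromov_product X q u v = a u v - a u q - a v q + mdist X p q" for u v
    unfolding a_def gromov_product_def mdist_commute[of X u q] mdist_commute[of X v q]
    by (simp add: field_simps)
  with four_point show "min (gromov_product X q x y) (gromov_product X q y z) \<le> gromov_product X q x z"
    by (auto simp: min_le_iff_disj)
qed

text \<open>If the Gromov product \<open>t\<close> of \<open>x\<close> and \<open>z\<close> at
  \<open>y\<close> were positive, hyperbolicity would make the two segments agree at distance
  \<open>t\<close> from \<open>y\<close>, against \<open>G1\<close> and \<open>G2\<close> meeting
  only in \<open>y\<close>. So the distances add up and the segments concatenate.\<close>

lemma metric_treeI_hyperbolic_at: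
  assumes geo: "geodesic_metric X" and X: "hyperbolic_at X p" and p: "p \<in> mspace X"
  shows "metric_tree X"
  unfolding metric_tree_def
proof (intro conjI ballI allI impI geo)
  fix x y z G1 G2
  assume xyz: "x \<in> mspace X" "y \<in> mspace X" "z \<in> mspace X"
    and G: "geodesic_segment X x y G1" "geodesic_segment X y z G2" "G1 \<inter> G2 = {y}"
  define t where "t = gromov_product X y x z"
  have "t \<le> 0"
  proof (rule ccontr)
    assume "\<not> t \<le> 0"
    then have "0 < t" by simp
    have t: "t \<le> mdist X y x" "t \<le> mdist X y z"
      using mdist_triangle[OF xyz(2,1,3)] mdist_triangle[OF xyz(2,3,1)]
      by (auto simp: t_def gromov_product_def mdist_commute)
    obtain f where f: "geodesic_path X y x f" "G1 = f ` {0..mdist X y x}"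
      using geodesic_segment_commute[OF G(1)] unfolding geodesic_segment_iff_path by blast
    obtain g where g: "geodesic_path X y z g" "G2 = g ` {0..mdist X y z}"
      using G(2) unfolding geodesic_segment_iff_path by blast
    have mem: "f t \<in> mspace X" "g t \<in> mspace X"
      using geodesic_pathD(3)[OF f(1), of t] geodesic_pathD(3)[OF g(1), of t] t \<open>0 < t\<close> by auto
    have d: "mdist X y (f t) = t" "mdist X (f t) x = mdist X y x - t"
        "mdist X y (g t) = t" "mdist X z (g t) = mdist X y z - t"
      using geodesic_pathD(1,2)[OF f(1)] geodesic_pathD(4)[OF f(1), of 0 t]
        geodesic_pathD(4)[OF f(1), of t "mdist X y x"] geodesic_pathD(1,2)[OF g(1)]
        geodesic_pathD(4)[OF g(1), of 0 t] geodesic_pathD(4)[OF g(1), of "mdist X y z" t] t \<open>0 < t\<close>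
      by auto
    have hyp: "hyperbolic_at X y" by (rule hyperbolic_at_change_base[OF X p xyz(2)])
    \<comment> \<open>In the chain \<open>f t\<close>, \<open>x\<close>, \<open>z\<close>,
      \<open>g t\<close> all consecutive products at \<open>y\<close> are \<open>t\<close>, so that
      of the two ends is at least \<open>t\<close>, which forces \<open>f t = g t\<close>.\<close>
    have "gromov_product X y (f t) x = t" "gromov_product X y z (g t) = t"
      using d by (auto simp: gromov_product_def)
    then have "t \<le> gromov_product X y (f t) (g t)"
      using hyperbolic_atD[OF hyp mem(1) xyz(1,3)] hyperbolic_atD[OF hyp mem(1) xyz(3) mem(2)]
      by (simp add: t_def)
    then have "mdist X (f t) (g t) = 0"
      using d mdist_nonneg[of X "f t" "g t"] by (simp add: gromov_product_def)
    then have "f t = g t" using mem by (simp only: mdist_zero)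
    moreover have "f t \<in> G1" "g t \<in> G2"
      unfolding f(2) g(2) by (intro imageI, use t \<open>0 < t\<close> in simp)+
    ultimately have "f t \<in> G1 \<inter> G2" by simp
    then have "f t = y" using G(3) by simp
    then show False using d(1) xyz(2) \<open>0 < t\<close> by simp
  qed
  then have "mdist X x z = mdist X x y + mdist X y z"
    using mdist_triangle[OF xyz] by (simp add: t_def gromov_product_def mdist_commute)
  then show "geodesic_segment X x z (G1 \<union> G2)" by (rule geodesic_segment_Un[OF G(1,2)])
qed

text \<open>Balls around the base point are convex: hyperbolicity for \<open>x\<close>,
  \<open>w\<close>, \<open>y\<close> bounds the height of \<open>w\<close> by that of one of the
  ends. This is why cutting a tree off at a radius leaves a geodesic space.\<close>

lemma geodesic_segment_in_ball:
  assumes X: "hyperbolic_at X p" and p: "p \<in> mspace X" and S: "geodesic_segment X x y S" "w \<in> S"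
    and r: "mdist X p x \<le> r" "mdist X p y \<le> r"
  shows "mdist X p w \<le> r"
proof -
  have mem: "x \<in> mspace X" "y \<in> mspace X" "w \<in> mspace X"
  proof -
    obtain f where "geodesic_path X x y f" using S(1) unfolding geodesic_segment_iff_path by blast
    then show "x \<in> mspace X" "y \<in> mspace X" by (rule geodesic_pathD(5), rule geodesic_pathD(6))
    show "w \<in> mspace X" using geodesic_segment_subset[OF S(1)] S(2) by blast
  qed
  have "mdist X p w \<le> mdist X p y - mdist X w y \<or> mdist X p w \<le> mdist X p x - mdist X x w"
    using hyperbolic_atD[OF X mem(1,3,2)] geodesic_segment_between[OF S]
    unfolding min_le_iff_disj gromov_product_def by (auto simp: field_simps)
  then show ?thesis
    using r mdist_nonneg[of X x w] mdist_nonneg[of X w y] by linarith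
qed

section \<open>The unit interval as a metric tree\<close>

definition unit_segment :: "real metric" where
  "unit_segment = submetric euclidean_metric {0..1}"

lemma mspace_unit_segment [simp]: "mspace unit_segment = {0..1}"
  and mdist_unit_segment [simp]: "mdist unit_segment x y = \<bar>x - y\<bar>"
  by (simp_all add: unit_segment_def dist_real_def)

lemma nonempty_compact_metric_unit_segment: "nonempty_compact_metric unit_segment"
  by (simp add: nonempty_compact_metric_def unit_segment_def mtopology_of_submetric
      compact_space_subtopology)

lemma metric_tree_unit_segment: "metric_tree unit_segment"
proof (rule metric_treeI_hyperbolic_at)
  have le: "\<exists>S. geodesic_segment unit_segment x y S" if "0 \<le> x" "x \<le> y" "y \<le> 1" for x y
  proof -
    have "geodesic_path unit_segment x y (\<lambda>s. x + s)"
      by (rule geodesic_pathI[where l = "y - x"]) (use that in auto)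
    then show ?thesis unfolding geodesic_segment_iff_path by blast
  qed
  show "geodesic_metric unit_segment"
    unfolding geodesic_metric_def
  proof (intro ballI)
    fix x y assume xy: "x \<in> mspace unit_segment" "y \<in> mspace unit_segment"
    show "\<exists>S. geodesic_segment unit_segment x y S"
    proof (cases "x \<le> y")
      case True
      then show ?thesis using le[of x y] xy by simp
    next
      case False
      then obtain S where "geodesic_segment unit_segment y x S" using le[of y x] xy by auto
      then have "geodesic_segment unit_segment x y S" by (rule geodesic_segment_commute)
      then show ?thesis ..
    qed
  qed
  have "gromov_product unit_segment 0 x y = min x y" if "0 \<le> x" "0 \<le> y" for x y
    using that by (simp add: gromov_product_def min_def)
  then show "hyperbolic_at unit_segment 0"
    unfolding hyperbolic_at_def by (auto simp: min_def)
qed simp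


section \<open>Wedges of rooted spaces\<close>

locale rooted_family =
  fixes T :: "'i \<Rightarrow> 'a metric" and bp :: "'i \<Rightarrow> 'a" and i0 :: 'i
  assumes bp: "bp i \<in> mspace (T i)"
begin

text \<open>The identified base points keep only the representative with index \<open>i0\<close>, so
  no quotient has to be formed.\<close>

definition wedge_carrier :: "('i \<times> 'a) set" where
  "wedge_carrier = {(i, p). p \<in> mspace (T i) \<and> (p = bp i \<longrightarrow> i = i0)}"

definition wedge_dist :: "'i \<times> 'a \<Rightarrow> 'i \<times> 'a \<Rightarrow> real" where
  "wedge_dist = (\<lambda>(i, p) (j, q). if i = j then mdist (T i) p q
                                 else mdist (T i) (bp i) p + mdist (T j) (bp j) q)"

definition wedge :: "('i \<times> 'a) metric" where
  "wedge = metric (wedge_carrier, wedge_dist)"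

definition hub :: "'i \<times> 'a" where
  "hub = (i0, bp i0)"

definition emb :: "'i \<Rightarrow> 'a \<Rightarrow> 'i \<times> 'a" where
  "emb i p = (if p = bp i then hub else (i, p))"

lemma wedge_dist_triangle:
  assumes "p \<in> mspace (T i)" "q \<in> mspace (T j)" "r \<in> mspace (T k)"
  shows "wedge_dist (i, p) (k, r) \<le> wedge_dist (i, p) (j, q) + wedge_dist (j, q) (k, r)"
proof -
  have pr: "i = k \<Longrightarrow> mdist (T i) p r \<le> mdist (T i) (bp i) p + mdist (T k) (bp k) r"
    using mdist_triangle[of p "T i" "bp i" r] assms bp[of i] by (simp add: mdist_commute)
  have pq: "i = j \<Longrightarrow> mdist (T i) (bp i) p \<le> mdist (T i) p q + mdist (T j) (bp j) q"
    using mdist_triangle[of "bp i" "T i" q p] assms bp[of i] by (simp add: mdist_commute)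
  have qr: "j = k \<Longrightarrow> mdist (T k) (bp k) r \<le> mdist (T j) (bp j) q + mdist (T j) q r"
    using mdist_triangle[of "bp j" "T j" q r] assms bp[of j] by simp
  have pqr: "i = j \<Longrightarrow> j = k \<Longrightarrow> mdist (T i) p r \<le> mdist (T i) p q + mdist (T j) q r"
    using mdist_triangle[of p "T i" q r] assms by simp
  have "0 \<le> mdist (T j) (bp j) q" by simp
  then show ?thesis
    using pr pq qr pqr unfolding wedge_dist_def by (auto intro: add_increasing)
qed

lemma Metric_space_wedge: "Metric_space wedge_carrier wedge_dist"
proof
  fix x y z
  show "0 \<le> wedge_dist x y" by (cases x; cases y) (simp add: wedge_dist_def)
  show "wedge_dist x y = wedge_dist y x"
    by (cases x; cases y) (auto simp: wedge_dist_def mdist_commute)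
  assume x: "x \<in> wedge_carrier" and y: "y \<in> wedge_carrier"
  obtain i p where ip: "x = (i, p)" "p \<in> mspace (T i)" "p = bp i \<Longrightarrow> i = i0"
    using x by (auto simp: wedge_carrier_def)
  obtain j q where jq: "y = (j, q)" "q \<in> mspace (T j)" "q = bp j \<Longrightarrow> j = i0"
    using y by (auto simp: wedge_carrier_def)
  show "wedge_dist x y = 0 \<longleftrightarrow> x = y"
  proof (cases "i = j")
    case True
    then show ?thesis using ip jq by (simp add: wedge_dist_def)
  next
    case False
    then have "mdist (T i) (bp i) p \<noteq> 0 \<or> mdist (T j) (bp j) q \<noteq> 0"
      using ip jq bp[of i] bp[of j] by auto
    then have "0 < mdist (T i) (bp i) p + mdist (T j) (bp j) q"
      using mdist_nonneg[of "T i" "bp i" p] mdist_nonneg[of "T j" "bp j" q] by linarith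
    then show ?thesis using False ip(1) jq(1) by (simp add: wedge_dist_def)
  qed
  assume "z \<in> wedge_carrier"
  then obtain k r where "z = (k, r)" "r \<in> mspace (T k)"
    by (auto simp: wedge_carrier_def)
  then show "wedge_dist x z \<le> wedge_dist x y + wedge_dist y z"
    using wedge_dist_triangle ip jq by simp
qed

lemma mspace_wedge [simp]: "mspace wedge = wedge_carrier"
  and mdist_wedge [simp]: "mdist wedge = wedge_dist"
  using Metric_space.mspace_metric[OF Metric_space_wedge] Metric_space.mdist_metric[OF Metric_space_wedge]
  by (simp_all add: wedge_def)

lemma emb_in_wedge: "p \<in> mspace (T i) \<Longrightarrow> emb i p \<in> wedge_carrier"
  using bp by (auto simp: emb_def hub_def wedge_carrier_def)

lemma emb_bp [simp]: "emb i (bp i) = hub"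
  by (simp add: emb_def)

lemma wedge_dist_emb:
  assumes "p \<in> mspace (T i)" "q \<in> mspace (T j)"
  shows "wedge_dist (emb i p) (emb j q) =
    (if i = j then mdist (T i) p q else mdist (T i) (bp i) p + mdist (T j) (bp j) q)"
  using assms bp[of i] bp[of j] bp[of i0] by (auto simp: emb_def hub_def wedge_dist_def mdist_commute)

lemma wedge_dist_hub_emb:
  "p \<in> mspace (T i) \<Longrightarrow> wedge_dist hub (emb i p) = mdist (T i) (bp i) p"
  using wedge_dist_emb[OF bp, of p i i] by simp

text \<open>Radius \<open>0\<close> reduces a factor to the hub. Factors can thus vanish
  continuously while the index set stays fixed.\<close>

definition cut :: "('i \<Rightarrow> real) \<Rightarrow> ('i \<times> 'a) set" where
  "cut \<rho> = {emb i p | i p. p \<in> mspace (T i) \<and> mdist (T i) (bp i) p \<le> \<rho> i}"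

definition trim :: "('i \<Rightarrow> real) \<Rightarrow> ('i \<times> 'a) metric" where
  "trim \<rho> = submetric wedge (cut \<rho>)"

lemma cut_subset: "cut \<rho> \<subseteq> wedge_carrier"
  by (auto simp: cut_def emb_in_wedge)

lemma mspace_trim [simp]: "mspace (trim \<rho>) = cut \<rho>"
  and mdist_trim [simp]: "mdist (trim \<rho>) = wedge_dist"
  using cut_subset by (auto simp: trim_def)

lemma emb_in_cut: "p \<in> mspace (T i) \<Longrightarrow> mdist (T i) (bp i) p \<le> \<rho> i \<Longrightarrow> emb i p \<in> cut \<rho>"
  by (auto simp: cut_def)

lemma cutE:
  assumes "x \<in> cut \<rho>"
  obtains i p where "p \<in> mspace (T i)" "mdist (T i) (bp i) p \<le> \<rho> i" "x = emb i p"
  using assms by (auto simp: cut_def)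

lemma hub_in_cut: "0 \<le> \<rho> i \<Longrightarrow> hub \<in> cut \<rho>"
  using emb_in_cut[of "bp i" i] bp[of i] by simp

lemma isometric_embedding_emb:
  "isometric_embedding (submetric (T i) {p. mdist (T i) (bp i) p \<le> \<rho> i}) (trim \<rho>) (emb i)"
  by (auto simp: isometric_embedding_def emb_in_cut wedge_dist_emb)

lemma isometric_embedding_emb_wedge: "isometric_embedding (T i) wedge (emb i)"
  by (auto simp: isometric_embedding_def emb_in_wedge wedge_dist_emb)

lemma gromov_product_trim:
  assumes "p \<in> mspace (T i)" "q \<in> mspace (T j)"
  shows "gromov_product (trim \<rho>) hub (emb i p) (emb j q) =
    (if i = j then gromov_product (T i) (bp i) p q else 0)"
  using assms by (simp add: gromov_product_def wedge_dist_hub_emb wedge_dist_emb)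

text \<open>Gromov products at the hub are nonnegative, and \<open>0\<close> across different
  factors, so the inequality has content only for three points of the same factor.\<close>

lemma hyperbolic_at_trim:
  assumes "\<And>i. hyperbolic_at (T i) (bp i)"
  shows "hyperbolic_at (trim \<rho>) hub"
  unfolding hyperbolic_at_def mspace_trim
proof (intro ballI)
  fix x y z assume "x \<in> cut \<rho>" "y \<in> cut \<rho>" "z \<in> cut \<rho>"
  then obtain i p j q k r where mem: "p \<in> mspace (T i)" "q \<in> mspace (T j)" "r \<in> mspace (T k)"
    and eq: "x = emb i p" "y = emb j q" "z = emb k r"
    by (elim cutE) blast
  have nonneg: "0 \<le> gromov_product (T l) (bp l) u v" if "u \<in> mspace (T l)" "v \<in> mspace (T l)" for l u v
    using mdist_triangle[OF that(1) bp that(2)] by (simp add: gromov_product_def mdist_commute)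
  have "min (gromov_product (T i) (bp i) p q) (gromov_product (T i) (bp i) q r)
      \<le> gromov_product (T i) (bp i) p r" if "j = i" "k = i"
    using hyperbolic_atD[OF assms[of i], of p q r] mem that by simp
  then show "min (gromov_product (trim \<rho>) hub x y) (gromov_product (trim \<rho>) hub y z)
      \<le> gromov_product (trim \<rho>) hub x z"
    unfolding eq gromov_product_trim[OF mem(1,2)] gromov_product_trim[OF mem(2,3)]
      gromov_product_trim[OF mem(1,3)]
    using nonneg[of p i r] mem by (auto simp: min_le_iff_disj)
qed

text \<open>Inside a factor, convexity of balls keeps geodesics in the trimmed part; between
  factors, geodesics are concatenated at the hub.\<close>

lemma geodesic_metric_trim:
  assumes geo: "\<And>i. geodesic_metric (T i)" and hyp: "\<And>i. hyperbolic_at (T i) (bp i)"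
    and \<rho>: "\<And>i. 0 \<le> \<rho> i"
  shows "geodesic_metric (trim \<rho>)"
  unfolding geodesic_metric_def mspace_trim
proof (intro ballI)
  have same: "\<exists>S. geodesic_segment (trim \<rho>) (emb i p) (emb i q) S"
    if p: "p \<in> mspace (T i)" "mdist (T i) (bp i) p \<le> \<rho> i"
      and q: "q \<in> mspace (T i)" "mdist (T i) (bp i) q \<le> \<rho> i" for i p q
  proof -
    obtain S where S: "geodesic_segment (T i) p q S"
      using geo[of i] p(1) q(1) unfolding geodesic_metric_def by blast
    have "S \<subseteq> {p. mdist (T i) (bp i) p \<le> \<rho> i}"
      using geodesic_segment_in_ball[OF hyp bp S _ p(2) q(2)] by blast
    from geodesic_segment_image[OF geodesic_segment_submetric[OF S this] isometric_embedding_emb[of i \<rho>]]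
    show ?thesis ..
  qed
  fix x y assume "x \<in> cut \<rho>" "y \<in> cut \<rho>"
  obtain i p where p: "p \<in> mspace (T i)" "mdist (T i) (bp i) p \<le> \<rho> i" "x = emb i p"
    using \<open>x \<in> cut \<rho>\<close> by (rule cutE)
  obtain j q where q: "q \<in> mspace (T j)" "mdist (T j) (bp j) q \<le> \<rho> j" "y = emb j q"
    using \<open>y \<in> cut \<rho>\<close> by (rule cutE)
  show "\<exists>S. geodesic_segment (trim \<rho>) x y S"
  proof (cases "i = j")
    case True
    then show ?thesis using same p q by simp
  next
    case False
    obtain S1 where S1: "geodesic_segment (trim \<rho>) x hub S1"
      using same[OF p(1,2) bp[of i]] \<rho>[of i] bp[of i] p(3) by auto
    obtain S2 where S2: "geodesic_segment (trim \<rho>) hub y S2"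
      using same[OF bp[of j] _ q(1,2)] \<rho>[of j] bp[of j] q(3) by auto
    have "mdist (trim \<rho>) x y = mdist (trim \<rho>) x hub + mdist (trim \<rho>) hub y"
      using False p q wedge_dist_emb[OF p(1) q(1)] wedge_dist_emb[OF p(1) bp[of i]]
      by (simp add: wedge_dist_hub_emb mdist_commute)
    from geodesic_segment_Un[OF S1 S2 this] show ?thesis ..
  qed
qed

lemma metric_tree_trim:
  assumes tree: "\<And>i. metric_tree (T i)" and \<rho>: "\<And>i. 0 \<le> \<rho> i"
  shows "metric_tree (trim \<rho>)"
proof (rule metric_treeI_hyperbolic_at)
  have hyp: "hyperbolic_at (T i) (bp i)" for i
    by (rule metric_tree_imp_hyperbolic_at[OF tree bp])
  have geo: "geodesic_metric (T i)" for i
    using tree[of i, unfolded metric_tree_def] by (rule conjunct1)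
  show "geodesic_metric (trim \<rho>)" by (rule geodesic_metric_trim[OF geo hyp \<rho>])
  show "hyperbolic_at (trim \<rho>) hub" by (rule hyperbolic_at_trim[OF hyp])
  show "hub \<in> mspace (trim \<rho>)" using hub_in_cut[of \<rho>] \<rho> by simp
qed

text \<open>An open set around the hub swallows every factor whose radius is small enough. By
  \<open>fin\<close> only finitely many compact pieces remain to be covered.\<close>

lemma nonempty_compact_metric_trim:
  assumes compact: "\<And>i. nonempty_compact_metric (T i)" and \<rho>: "\<And>i. 0 \<le> \<rho> i"
    and fin: "\<And>e. 0 < e \<Longrightarrow> finite {i. e \<le> \<rho> i}"
  shows "nonempty_compact_metric (trim \<rho>)"
proof -
  interpret W: Metric_space wedge_carrier wedge_dist by (rule Metric_space_wedge)
  have top: "mtopology_of wedge = W.mtopology" by (simp add: mtopology_of_def)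
  define K where "K i = emb i ` {p \<in> mspace (T i). mdist (T i) (bp i) p \<le> \<rho> i}" for i
  have K: "compactin W.mtopology (K i)" for i
  proof -
    interpret Ti: Metric_space "mspace (T i)" "mdist (T i)" by simp
    have "compact_space (mtopology_of (T i))"
      using compact[of i] by (simp add: nonempty_compact_metric_def)
    moreover have "{p \<in> mspace (T i). mdist (T i) (bp i) p \<le> \<rho> i} = Ti.mcball (bp i) (\<rho> i)"
      using bp by auto
    then have "closedin (mtopology_of (T i)) {p \<in> mspace (T i). mdist (T i) (bp i) p \<le> \<rho> i}"
      by (simp add: mtopology_of_def)
    ultimately have "compactin (mtopology_of (T i)) {p \<in> mspace (T i). mdist (T i) (bp i) p \<le> \<rho> i}"
      by (rule closedin_compact_space)
    then show ?thesis
      unfolding K_def top[symmetric]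
      by (rule image_compactin)
        (rule isometric_embedding_imp_continuous_map[OF isometric_embedding_emb_wedge])
  qed
  have K_cut: "K i \<subseteq> cut \<rho>" for i by (auto simp: K_def emb_in_cut)
  have "compactin W.mtopology (cut \<rho>)"
    unfolding compactin_def
  proof (intro conjI allI impI)
    show "cut \<rho> \<subseteq> topspace W.mtopology" using cut_subset by simp
    fix \<U> assume "Ball \<U> (openin W.mtopology) \<and> cut \<rho> \<subseteq> \<Union> \<U>"
    then have \<U>: "Ball \<U> (openin W.mtopology)" "cut \<rho> \<subseteq> \<Union> \<U>" by simp_all
    have "hub \<in> cut \<rho>" using hub_in_cut[of \<rho>] \<rho> by blast
    then obtain U where U: "U \<in> \<U>" "hub \<in> U" using \<U>(2) by blast
    then obtain e where e: "0 < e" "W.mball hub e \<subseteq> U"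
      using \<U>(1) unfolding W.openin_mtopology by blast
    have "compactin W.mtopology (\<Union>i\<in>{i. e \<le> \<rho> i}. K i)"
      by (rule compactin_Union) (use fin[OF e(1)] K in auto)
    moreover have "(\<Union>i\<in>{i. e \<le> \<rho> i}. K i) \<subseteq> \<Union>\<U>" using K_cut \<U>(2) by blast
    ultimately obtain \<F> where \<F>: "finite \<F>" "\<F> \<subseteq> \<U>" "(\<Union>i\<in>{i. e \<le> \<rho> i}. K i) \<subseteq> \<Union>\<F>"
      using \<U>(1) unfolding compactin_def by meson
    have "cut \<rho> \<subseteq> \<Union>(insert U \<F>)"
    proof
      fix x assume x: "x \<in> cut \<rho>"
      then obtain i p where p: "p \<in> mspace (T i)" "mdist (T i) (bp i) p \<le> \<rho> i" "x = emb i p"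
        by (rule cutE)
      show "x \<in> \<Union>(insert U \<F>)"
      proof (cases "e \<le> \<rho> i")
        case True
        then have "x \<in> (\<Union>i\<in>{i. e \<le> \<rho> i}. K i)" using p by (auto simp: K_def)
        then show ?thesis using \<F>(3) by blast
      next
        case False
        then have "wedge_dist hub x < e" using p by (simp add: wedge_dist_hub_emb)
        then have "x \<in> W.mball hub e"
          using x \<open>hub \<in> cut \<rho>\<close> cut_subset by (auto simp: W.in_mball)
        then show ?thesis using e(2) by blast
      qed
    qed
    then show "\<exists>\<F>. finite \<F> \<and> \<F> \<subseteq> \<U> \<and> cut \<rho> \<subseteq> \<Union> \<F>"
      using \<F>(1,2) U(1) by (intro exI[of _ "insert U \<F>"]) simp
  qed
  then have "compact_space (mtopology_of (trim \<rho>))"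
    by (simp add: trim_def mtopology_of_submetric top compact_space_subtopology)
  moreover have "cut \<rho> \<noteq> {}" using hub_in_cut[of \<rho>] \<rho> by blast
  ultimately show ?thesis by (simp add: nonempty_compact_metric_def)
qed

text \<open>A point beyond radius \<open>\<sigma> i\<close> is pulled back along its geodesic to the
  base point until it has that radius, which moves it by at most \<open>e\<close>.\<close>

lemma trim_near:
  assumes geo: "\<And>i. geodesic_metric (T i)" and \<sigma>: "\<And>i. 0 \<le> \<sigma> i" and le: "\<And>i. \<rho> i \<le> \<sigma> i + e"
    and "0 \<le> e" and x: "x \<in> cut \<rho>"
  shows "\<exists>y\<in>cut \<sigma>. wedge_dist x y \<le> e"
proof -
  obtain i p where p: "p \<in> mspace (T i)" "mdist (T i) (bp i) p \<le> \<rho> i" "x = emb i p"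
    using x by (rule cutE)
  show ?thesis
  proof (cases "mdist (T i) (bp i) p \<le> \<sigma> i")
    case True
    then have "x \<in> cut \<sigma>" using p emb_in_cut by simp
    moreover have "wedge_dist x x \<le> e" using p \<open>0 \<le> e\<close> by (simp add: wedge_dist_emb)
    ultimately show ?thesis ..
  next
    case False
    obtain f where f: "geodesic_path (T i) (bp i) p f"
      using geo[of i] bp[of i] p(1) unfolding geodesic_metric_def geodesic_segment_iff_path by blast
    have f\<sigma>: "f (\<sigma> i) \<in> mspace (T i)" "mdist (T i) (bp i) (f (\<sigma> i)) = \<sigma> i"
      "mdist (T i) p (f (\<sigma> i)) = mdist (T i) (bp i) p - \<sigma> i"
      using geodesic_pathD(3)[OF f, of "\<sigma> i"] geodesic_pathD(1,2)[OF f] geodesic_pathD(4)[OF f, of 0 "\<sigma> i"]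
        geodesic_pathD(4)[OF f, of "mdist (T i) (bp i) p" "\<sigma> i"] \<sigma>[of i] False
      by auto
    have "emb i (f (\<sigma> i)) \<in> cut \<sigma>" using f\<sigma>(1,2) by (simp add: emb_in_cut)
    moreover have "wedge_dist x (emb i (f (\<sigma> i))) \<le> e"
      using p f\<sigma> le[of i] by (simp add: wedge_dist_emb)
    ultimately show ?thesis ..
  qed
qed

text \<open>Both spaces sit in the same wedge, where closeness up to \<open>e\<close> is the
  correspondence. The Gromov-Hausdorff distance is thus controlled by the uniform distance of the
  radii.\<close>

lemma correspondence_trim:
  assumes geo: "\<And>i. geodesic_metric (T i)" and nonneg: "\<And>i. 0 \<le> \<rho> i" "\<And>i. 0 \<le> \<sigma> i"
    and le: "\<And>i. \<bar>\<rho> i - \<sigma> i\<bar> \<le> e" and "0 \<le> e"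
  shows "correspondence (trim \<rho>) (trim \<sigma>) e {(x, y). x \<in> cut \<rho> \<and> y \<in> cut \<sigma> \<and> wedge_dist x y \<le> e}"
proof (rule correspondenceI; unfold mspace_trim mdist_trim)
  interpret W: Metric_space wedge_carrier wedge_dist by (rule Metric_space_wedge)
  have le1: "\<rho> i \<le> \<sigma> i + e" and le2: "\<sigma> i \<le> \<rho> i + e" for i using le[of i] by linarith+
  show "\<exists>y. (x, y) \<in> {(x, y). x \<in> cut \<rho> \<and> y \<in> cut \<sigma> \<and> wedge_dist x y \<le> e}" if "x \<in> cut \<rho>" for x
    using trim_near[OF geo nonneg(2) le1 \<open>0 \<le> e\<close> that] that by blast
  show "\<exists>x. (x, y) \<in> {(x, y). x \<in> cut \<rho> \<and> y \<in> cut \<sigma> \<and> wedge_dist x y \<le> e}" if y: "y \<in> cut \<sigma>" for y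
  proof -
    obtain x where "x \<in> cut \<rho>" "wedge_dist y x \<le> e"
      using trim_near[OF geo nonneg(1) le2 \<open>0 \<le> e\<close> y] by blast
    then show ?thesis using y W.commute[of y x] by (intro exI[of _ x]) simp
  qed
  fix x y x' y'
  assume "(x, y) \<in> {(x, y). x \<in> cut \<rho> \<and> y \<in> cut \<sigma> \<and> wedge_dist x y \<le> e}"
    "(x', y') \<in> {(x, y). x \<in> cut \<rho> \<and> y \<in> cut \<sigma> \<and> wedge_dist x y \<le> e}"
  then have d: "wedge_dist x y \<le> e" "wedge_dist x' y' \<le> e"
    and mem: "x \<in> wedge_carrier" "y \<in> wedge_carrier" "x' \<in> wedge_carrier" "y' \<in> wedge_carrier"
    using cut_subset by auto
  show "\<bar>wedge_dist x x' - wedge_dist y y'\<bar> \<le> 2 * e"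
    using d W.triangle[OF mem(1,2,3)] W.triangle[OF mem(2,4,3)] W.triangle[OF mem(2,1,4)]
      W.triangle[OF mem(1,3,4)] W.commute[of x' y'] W.commute[of x y] by (smt (verit))
qed auto

lemma isometric_trim_single:
  assumes "\<And>p. p \<in> mspace (T i) \<Longrightarrow> mdist (T i) (bp i) p \<le> \<rho> i" and "\<And>j. j \<noteq> i \<Longrightarrow> \<rho> j = 0"
  shows "isometric (T i) (trim \<rho>)"
proof -
  have sub: "emb i ` mspace (T i) \<subseteq> cut \<rho>" using assms(1) by (auto simp: emb_in_cut)
  moreover have "cut \<rho> \<subseteq> emb i ` mspace (T i)"
  proof
    fix x assume "x \<in> cut \<rho>"
    then obtain j p where p: "p \<in> mspace (T j)" "mdist (T j) (bp j) p \<le> \<rho> j" "x = emb j p"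
      by (rule cutE)
    show "x \<in> emb i ` mspace (T i)"
    proof (cases "j = i")
      case False
      then have "mdist (T j) (bp j) p = 0" using p(2) assms(2) mdist_nonneg[of "T j" "bp j" p] by simp
      then have "bp j = p" using p(1) bp[of j] by (simp only: mdist_zero)
      then have "x = emb i (bp i)" using p(3) by (auto simp only: emb_bp)
      then show ?thesis using bp[of i] by blast
    qed (use p in simp)
  qed
  ultimately have "emb i ` mspace (T i) = cut \<rho>" by (rule subset_antisym)
  moreover have "isometric_embedding (T i) (trim \<rho>) (emb i)"
    using sub by (simp add: isometric_embedding_def wedge_dist_emb)
  ultimately show ?thesis unfolding isometric_def by auto
qed

text \<open>Points in factors outside \<open>J\<close> lie within \<open>c\<close> of the hub. All
  such points together contribute at most one element to \<open>S\<close>, the others are counted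
  factor by factor.\<close>

lemma separated_trim_card_le:
  assumes S: "separated (trim \<rho>) (2 * c) S" and J: "finite J" "\<And>i. i \<notin> J \<Longrightarrow> \<rho> i \<le> c"
    and N: "\<And>i A. i \<in> J \<Longrightarrow> separated (T i) (2 * c) A \<Longrightarrow> finite A \<and> card A \<le> N i"
  shows "card S \<le> 1 + (\<Sum>i\<in>J. N i)"
proof -
  interpret W: Metric_space wedge_carrier wedge_dist by (rule Metric_space_wedge)
  have S': "S \<subseteq> cut \<rho>" "\<And>x y. x \<in> S \<Longrightarrow> y \<in> S \<Longrightarrow> x \<noteq> y \<Longrightarrow> 2 * c < wedge_dist x y"
    using S by (auto simp: separated_def pairwise_def)
  define B where "B = {x \<in> S. wedge_dist hub x \<le> c}"
  define A where "A i = {p \<in> mspace (T i). emb i p \<in> S}" for i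
  have hub: "hub \<in> wedge_carrier" using emb_in_wedge[OF bp] by simp
  have "x = y" if "x \<in> B" "y \<in> B" for x y
  proof (rule ccontr)
    assume "x \<noteq> y"
    have "x \<in> wedge_carrier" "y \<in> wedge_carrier" using that S'(1) cut_subset by (auto simp: B_def)
    then show False
      using W.triangle[OF _ hub, of x y] that S'(2)[OF _ _ \<open>x \<noteq> y\<close>] W.commute[of hub x]
      by (auto simp: B_def)
  qed
  then have B: "card B \<le> 1" "finite B"
    by (metis card_le_Suc0_iff_eq One_nat_def is_singletonI' card.infinite is_singleton_def finite.simps le0 nle_le)+
  have A: "finite (A i)" "card (A i) \<le> N i" if "i \<in> J" for i
  proof -
    have "separated (T i) (2 * c) (A i)"
      unfolding separated_def pairwise_def
    proof (intro conjI ballI impI)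
      fix p q assume pq: "p \<in> A i" "q \<in> A i" "p \<noteq> q"
      then have m: "p \<in> mspace (T i)" "q \<in> mspace (T i)" by (auto simp: A_def)
      have "emb i p \<noteq> emb i q"
        using wedge_dist_emb[OF m] wedge_dist_emb[OF m(1,1)] pq(3) m by auto
      then show "2 * c < mdist (T i) p q"
        using S'(2)[of "emb i p" "emb i q"] pq wedge_dist_emb[OF m] by (auto simp: A_def)
    qed (auto simp: A_def)
    with N[OF that] show "finite (A i)" "card (A i) \<le> N i" by blast+
  qed
  have "S \<subseteq> B \<union> (\<Union>i\<in>J. emb i ` A i)"
  proof
    fix x assume x: "x \<in> S"
    then obtain i p where p: "p \<in> mspace (T i)" "mdist (T i) (bp i) p \<le> \<rho> i" "x = emb i p"
      using S'(1) cutE by blast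
    show "x \<in> B \<union> (\<Union>i\<in>J. emb i ` A i)"
    proof (cases "i \<in> J")
      case True
      then show ?thesis using p x by (auto simp: A_def)
    next
      case False
      then show ?thesis using p x J(2)[of i] by (auto simp: B_def wedge_dist_hub_emb)
    qed
  qed
  then have "card S \<le> card (B \<union> (\<Union>i\<in>J. emb i ` A i))"
    by (rule card_mono[rotated]) (use B(2) J(1) A(1) in auto)
  also have "\<dots> \<le> card B + (\<Sum>i\<in>J. card (emb i ` A i))"
    by (rule order_trans[OF card_Un_le]) (simp add: card_UN_le[OF J(1)])
  also have "\<dots> \<le> 1 + (\<Sum>i\<in>J. N i)"
    by (intro add_mono B(1) sum_mono order_trans[OF card_image_le[OF A(1)] A(2)])
  finally show ?thesis .
qed

text \<open>A route between different factors passes the hub, so tips at height above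
  \<open>c\<close> are more than \<open>2 * c\<close> apart.\<close>

lemma separated_trim_tips:
  assumes "\<And>i. i \<in> I \<Longrightarrow> p i \<in> mspace (T i) \<and> mdist (T i) (bp i) (p i) = \<rho> i \<and> c < \<rho> i"
    and "0 \<le> c"
  shows "separated (trim \<rho>) (2 * c) ((\<lambda>i. emb i (p i)) ` I)" "card ((\<lambda>i. emb i (p i)) ` I) = card I"
proof -
  have d: "2 * c < wedge_dist (emb i (p i)) (emb j (p j))" if "i \<in> I" "j \<in> I" "i \<noteq> j" for i j
    using assms(1)[OF that(1)] assms(1)[OF that(2)] that(3) by (simp add: wedge_dist_emb)
  then show "separated (trim \<rho>) (2 * c) ((\<lambda>i. emb i (p i)) ` I)"
    using assms(1) by (auto simp: separated_def pairwise_def emb_in_cut)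
  have "inj_on (\<lambda>i. emb i (p i)) I"
  proof (rule inj_onI, rule ccontr)
    fix i j assume ij: "i \<in> I" "j \<in> I" "emb i (p i) = emb j (p j)" "i \<noteq> j"
    then show False
      using d[OF ij(1,2,4)] wedge_dist_emb[of "p i" i "p i" i] assms(1)[OF ij(1)] assms(2) by simp
  qed
  then show "card ((\<lambda>i. emb i (p i)) ` I) = card I" by (rule card_image)
qed

end


section \<open>The family of coding trees\<close>

text \<open>Carrying the running sum \<open>B\<close> along turns the course-of-values recursion
  into a primitive one.\<close>

lemma recursive_multiplicities:
  fixes g c :: "nat \<Rightarrow> nat"
  shows "\<exists>M. \<forall>j. M j = g j + c j * (\<Sum>l<j. M l)"
proof -
  define B where "B = rec_nat 0 (\<lambda>j b. b + (g j + c j * b))"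
  define M where "M j = g j + c j * B j" for j
  have B: "B j = (\<Sum>l<j. M l)" for j
    by (induction j) (simp_all add: B_def M_def)
  have "M j = g j + c j * (\<Sum>l<j. M l)" for j
    unfolding B[symmetric] by (rule M_def)
  then show ?thesis by blast
qed

text \<open>The index \<open>(0, i)\<close> stands for the prescribed tree \<open>Y i\<close> and \<open>(Suc j, i)\<close>, with \<open>i < M j\<close>, for
  the \<open>i\<close>-th leg of level \<open>j\<close>. The recursion for \<open>M\<close> makes level \<open>j\<close> have more legs than there
  can be \<open>2 * (1 / 2) ^ Suc j\<close>-separated points in the prescribed trees and the earlier levels.\<close>

locale tree_coding =
  fixes I :: "nat set" and Y :: "nat \<Rightarrow> real metric" and b :: "nat \<Rightarrow> real" and C :: "nat \<Rightarrow> real"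
    and H :: "'h metric" and v :: "nat \<Rightarrow> 'h" and q :: "nat \<Rightarrow> 'h"
    and NY :: "nat \<Rightarrow> nat \<Rightarrow> nat" and NU :: "nat \<Rightarrow> nat" and M :: "nat \<Rightarrow> nat"
  assumes finite_I: "finite I"
    and compact_Y: "\<And>i. nonempty_compact_metric (Y i)"
    and tree_Y: "\<And>i. metric_tree (Y i)"
    and b: "\<And>i. b i \<in> mspace (Y i)"
    and C_nonneg: "\<And>i. i \<in> I \<Longrightarrow> 0 \<le> C i"
    and C: "\<And>i p. i \<in> I \<Longrightarrow> p \<in> mspace (Y i) \<Longrightarrow>
      mdist (Y i) (b i) p \<le> C i * (\<Prod>l\<in>I - {i}. mdist H (v i) (v l))"
    and v: "\<And>i. i \<in> I \<Longrightarrow> v i \<in> mspace H"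
    and q: "\<And>k. q k \<in> mspace H"
    and q_dense: "\<And>x e. x \<in> mspace H \<Longrightarrow> 0 < e \<Longrightarrow> \<exists>k. mdist H (q k) x < e"
    and NY: "\<And>i j A. i \<in> I \<Longrightarrow> separated (Y i) (2 * (1 / 2) ^ Suc j) A \<Longrightarrow> finite A \<and> card A \<le> NY i j"
    and NU: "\<And>j A. separated unit_segment (2 * (1 / 2) ^ Suc j) A \<Longrightarrow> finite A \<and> card A \<le> NU j"
    and M: "\<And>j. M j = 2 + (\<Sum>i\<in>I. NY i j) + NU j * (\<Sum>l<j. M l)"
begin

definition T :: "nat \<times> nat \<Rightarrow> real metric" where
  "T = (\<lambda>(k, i). if k = 0 then Y i else unit_segment)"

definition bp :: "nat \<times> nat \<Rightarrow> real" where
  "bp = (\<lambda>(k, i). if k = 0 then b i else 0)"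

text \<open>On \<open>H\<close> this vanishes exactly at the points \<open>v l\<close>, where it has
  to remove all legs.\<close>

definition gap :: "'h \<Rightarrow> real" where
  "gap x = (\<Prod>l\<in>I. mdist H x (v l))"

text \<open>\<open>prod_decode\<close> makes every point of the dense sequence control the leg lengths of
  infinitely many levels.\<close>

definition len :: "nat \<Rightarrow> 'h \<Rightarrow> real" where
  "len j x = (1 / 2) ^ Suc j * (1 + min 1 (mdist H x (q (fst (prod_decode j)))))"

text \<open>The product for \<open>(0, i)\<close> omits \<open>l = i\<close>: it is positive at
  \<open>v i\<close>, where \<open>C i\<close> scales it up to the full radius of
  \<open>Y i\<close>, and vanishes at all the other vertices. Indices that stand for no tree or leg
  get radius \<open>0\<close>.\<close>

definition cutoff :: "'h \<Rightarrow> nat \<times> nat \<Rightarrow> real" where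
  "cutoff x = (\<lambda>(k, i). case k of
      0 \<Rightarrow> if i \<in> I then C i * (\<Prod>l\<in>I - {i}. mdist H x (v l)) else 0
    | Suc j \<Rightarrow> if i < M j then min (gap x) (len j x) else 0)"

lemma T_simps [simp]: "T (0, i) = Y i" "T (Suc j, i) = unit_segment"
  and bp_simps [simp]: "bp (0, i) = b i" "bp (Suc j, i) = 0"
  by (simp_all add: T_def bp_def)

lemma cutoff_simps:
  "cutoff x (0, i) = (if i \<in> I then C i * (\<Prod>l\<in>I - {i}. mdist H x (v l)) else 0)"
  "cutoff x (Suc j, i) = (if i < M j then min (gap x) (len j x) else 0)"
  by (simp_all add: cutoff_def)

sublocale rooted_family T bp "(0, 0)"
proof
  fix k show "bp k \<in> mspace (T k)" using b by (simp add: T_def bp_def split: prod.split)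
qed

abbreviation tree :: "'h \<Rightarrow> ((nat \<times> nat) \<times> real) metric" where
  "tree x \<equiv> trim (cutoff x)"

section \<open>The coding trees are compact metric trees with prescribed values at the
  vertices\<close>

lemma compact_T: "nonempty_compact_metric (T k)"
  using compact_Y nonempty_compact_metric_unit_segment by (simp add: T_def split: prod.split)

lemma tree_T: "metric_tree (T k)"
  using tree_Y metric_tree_unit_segment by (simp add: T_def split: prod.split)

lemma gap_nonneg: "0 \<le> gap x"
  by (simp add: gap_def prod_nonneg)

lemma len_bounds: "(1 / 2) ^ Suc j \<le> len j x" "len j x \<le> (1 / 2) ^ j"
proof -
  have "0 \<le> min 1 (mdist H x (q (fst (prod_decode j))))" by simp
  then have "(1 / 2) ^ Suc j * 1 \<le> len j x" unfolding len_def by (intro mult_left_mono) auto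
  then show "(1 / 2) ^ Suc j \<le> len j x" by simp
  have "len j x \<le> (1 / 2) ^ Suc j * 2" unfolding len_def by (intro mult_left_mono) auto
  then show "len j x \<le> (1 / 2) ^ j" by simp
qed

lemma len_pos: "0 < len j x"
  using len_bounds(1)[of j x] zero_less_power[of "1 / 2 :: real" "Suc j"] by linarith

lemma cutoff_nonneg: "0 \<le> cutoff x k"
proof (cases k)
  case (Pair j i)
  then show ?thesis
    using gap_nonneg[of x] len_pos C_nonneg
    by (cases j) (auto simp: cutoff_simps less_imp_le intro!: mult_nonneg_nonneg prod_nonneg)
qed

lemma half_power_less:
  assumes "0 < (e :: real)" obtains j where "(1 / 2) ^ j < e"
  using real_arch_pow_inv[OF assms, of "1 / 2"] by auto

lemma half_power_mono: "i \<le> j \<Longrightarrow> (1 / 2 :: real) ^ j \<le> (1 / 2) ^ i"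
  by (rule power_decreasing) auto

definition low :: "nat \<Rightarrow> (nat \<times> nat) set" where
  "low j = Pair 0 ` I \<union> (\<lambda>(l, i). (Suc l, i)) ` (SIGMA l:{..<j}. {..<M l})"

lemma finite_low: "finite (low j)"
  using finite_I by (auto simp: low_def)

text \<open>The ranges of the lengths on successive levels meet at most in end points: for
  \<open>l > j\<close>, \<open>len l x\<close> is at most \<open>(1 / 2) ^ Suc j\<close>, hence at
  most \<open>len j x\<close>.\<close>

lemma cutoff_not_low:
  assumes "k \<notin> low j" shows "cutoff x k \<le> len j x"
proof (cases k)
  case (Pair a i)
  show ?thesis
  proof (cases a)
    case 0
    then show ?thesis using Pair assms len_pos[of j x] by (auto simp: low_def cutoff_simps)
  next
    case (Suc l)
    show ?thesis
    proof (cases "i < M l")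
      case True
      then have "j \<le> l" using assms Pair Suc by (force simp: low_def)
      have "len l x \<le> len j x"
      proof (cases "l = j")
        case False
        then have "Suc j \<le> l" using \<open>j \<le> l\<close> by simp
        then show ?thesis
          using len_bounds(2)[of l x] half_power_mono[of "Suc j" l] len_bounds(1)[of j x] by linarith
      qed simp
      then show ?thesis using Pair Suc True by (simp add: cutoff_simps)
    next
      case False
      then show ?thesis using Pair Suc len_pos[of j x] by (simp add: cutoff_simps)
    qed
  qed
qed

lemma finite_cutoff_ge:
  assumes "0 < e" shows "finite {k. e \<le> cutoff x k}"
proof -
  obtain j where j: "(1 / 2) ^ j < e" using half_power_less[OF assms] .
  have "{k. e \<le> cutoff x k} \<subseteq> low j"
  proof (rule subsetI, rule ccontr)
    fix k assume "k \<in> {k. e \<le> cutoff x k}" "k \<notin> low j"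
    then show False using cutoff_not_low[of k j x] len_bounds(2)[of j x] j by simp
  qed
  then show ?thesis using finite_low finite_subset by blast
qed

lemma compact_tree: "nonempty_compact_metric (tree x)"
  by (rule nonempty_compact_metric_trim[OF compact_T cutoff_nonneg finite_cutoff_ge])

lemma metric_tree_tree: "metric_tree (tree x)"
  by (rule metric_tree_trim[OF tree_T cutoff_nonneg])

lemma isometric_tree_vertex:
  assumes i: "i \<in> I" shows "isometric (Y i) (tree (v i))"
proof -
  have "isometric (T (0, i)) (tree (v i))"
  proof (rule isometric_trim_single)
    show "mdist (T (0, i)) (bp (0, i)) p \<le> cutoff (v i) (0, i)" if "p \<in> mspace (T (0, i))" for p
      using C[OF i] i that by (simp add: cutoff_simps)
    \<comment> \<open>Applied to \<open>I\<close> for the legs, and to \<open>I - {l}\<close> with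
      \<open>l\<close> different from \<open>i\<close> for the other prescribed trees.\<close>
    have zero: "(\<Prod>l\<in>A. mdist H (v i) (v l)) = 0" if "i \<in> A" "finite A" for A
      using that v[OF i] by (intro prod_zero bexI[of _ i]) auto
    show "cutoff (v i) k = 0" if "k \<noteq> (0, i)" for k
    proof (cases k)
      case (Pair a l)
      show ?thesis
      proof (cases a)
        case 0
        then show ?thesis using Pair that i finite_I zero[of "I - {l}"] by (simp add: cutoff_simps)
      next
        case (Suc j)
        have "gap (v i) = 0" unfolding gap_def by (rule zero[OF i finite_I])
        then show ?thesis using Pair Suc len_pos[of j "v i"] by (simp add: cutoff_simps)
      qed
    qed
  qed
  then show ?thesis by simp
qed

text \<open>The Lipschitz constant does not depend on \<open>j\<close>, so infinitely many legs are
  controlled at once.\<close>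

lemma len_lipschitz:
  assumes "x \<in> mspace H" "y \<in> mspace H" shows "\<bar>len j x - len j y\<bar> \<le> mdist H x y"
proof -
  define p where "p = q (fst (prod_decode j))"
  have p: "p \<in> mspace H" by (simp add: p_def q)
  have "\<bar>min 1 (mdist H x p) - min 1 (mdist H y p)\<bar> \<le> mdist H x y"
    using mdist_triangle[OF assms p] mdist_triangle[OF assms(2,1) p] mdist_commute[of H x y]
    by (smt (verit))
  moreover have "\<bar>len j x - len j y\<bar> = (1 / 2) ^ Suc j * \<bar>min 1 (mdist H x p) - min 1 (mdist H y p)\<bar>"
  proof -
    have "len j x - len j y = (1 / 2) ^ Suc j * (min 1 (mdist H x p) - min 1 (mdist H y p))"
      unfolding len_def p_def[symmetric] by (simp only: right_diff_distrib[symmetric] add_diff_cancel_left)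
    then show ?thesis by (simp only: abs_mult) simp
  qed
  moreover have "(1 / 2 :: real) ^ Suc j \<le> 1" by (rule power_le_one) auto
  then have "(1 / 2) ^ Suc j * \<bar>min 1 (mdist H x p) - min 1 (mdist H y p)\<bar>
      \<le> \<bar>min 1 (mdist H x p) - min 1 (mdist H y p)\<bar>"
    by (intro mult_left_le_one_le) auto
  ultimately show ?thesis by linarith
qed

text \<open>The neighbourhood must serve all indices simultaneously. The single continuous function
  \<open>\<omega>\<close> dominates every difference of radii: a finite sum handles the prescribed
  trees, and \<open>gap\<close> with the distance to \<open>x\<close> handles all legs.\<close>

lemma cutoff_continuous:
  assumes x: "x \<in> mspace H" and "0 < e"
  obtains U where "openin (mtopology_of H) U" "x \<in> U"
    "\<And>y k. y \<in> U \<Longrightarrow> \<bar>cutoff x k - cutoff y k\<bar> \<le> e"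
proof -
  let ?H = "mtopology_of H"
  have dist: "continuous_map ?H euclideanreal (\<lambda>y. mdist H y p)" if "p \<in> mspace H" for p
    by (rule continuous_map_mdist) (use that in auto)
  have prod: "continuous_map ?H euclideanreal (\<lambda>y. \<Prod>l\<in>A. mdist H y (v l))" if "A \<subseteq> I" for A
    by (rule continuous_map_prod) (use that finite_I v finite_subset in \<open>auto intro!: dist\<close>)
  define \<omega> where "\<omega> y = (\<Sum>i\<in>I. \<bar>cutoff x (0, i) - cutoff y (0, i)\<bar>) + \<bar>gap x - gap y\<bar> + mdist H y x" for y
  have "continuous_map ?H euclideanreal \<omega>"
    unfolding \<omega>_def gap_def cutoff_simps using finite_I
    by (intro continuous_map_add continuous_map_sum continuous_map_real_abs continuous_map_diff
        continuous_map_real_mult prod dist x) (auto intro!: continuous_map_real_mult prod)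
  then have "openin ?H {y \<in> topspace ?H. \<omega> y \<in> {..<e}}"
    by (rule openin_continuous_map_preimage) simp
  moreover have "\<omega> x = 0" using x by (simp add: \<omega>_def)
  then have "x \<in> {y \<in> topspace ?H. \<omega> y \<in> {..<e}}" using x \<open>0 < e\<close> by simp
  moreover have "\<bar>cutoff x k - cutoff y k\<bar> \<le> e" if y: "y \<in> {y \<in> topspace ?H. \<omega> y \<in> {..<e}}" for y k
  proof -
    have y: "y \<in> mspace H" "\<omega> y < e" using y by auto
    define s where "s = (\<Sum>i\<in>I. \<bar>cutoff x (0, i) - cutoff y (0, i)\<bar>)"
    have s: "0 \<le> s" "0 \<le> mdist H y x" "s + \<bar>gap x - gap y\<bar> + mdist H y x < e"
      using y(2) by (auto simp: s_def \<omega>_def sum_nonneg)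
    obtain a i where k: "k = (a, i)" by (cases k)
    show ?thesis
    proof (cases a)
      case 0
      show ?thesis
      proof (cases "i \<in> I")
        case True
        then have "\<bar>cutoff x (0, i) - cutoff y (0, i)\<bar> \<le> s"
          unfolding s_def using finite_I by (intro member_le_sum) auto
        then have "\<bar>cutoff x (0, i) - cutoff y (0, i)\<bar> \<le> e"
          using s abs_ge_zero[of "gap x - gap y"] by linarith
        then show ?thesis using k 0 by simp
      next
        case False
        then show ?thesis using k 0 \<open>0 < e\<close> by (simp add: cutoff_simps)
      qed
    next
      case (Suc j)
      have "\<bar>min (gap x) (len j x) - min (gap y) (len j y)\<bar> \<le> e"
        using s len_lipschitz[OF x y(1), of j] mdist_commute[of H x y] by (smt (verit))
      then show ?thesis using k Suc \<open>0 < e\<close> by (simp add: cutoff_simps)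
    qed
  qed
  ultimately show thesis by (rule that)
qed

text \<open>At this scale everything outside \<open>low j\<close> counts for one point. The bounds
  \<open>NY\<close> and \<open>NU\<close> are taken at the smaller scale
  \<open>2 * (1 / 2) ^ Suc j\<close>, so they serve every \<open>x\<close>.\<close>

lemma separated_tree_card_less:
  assumes S: "separated (tree x) (2 * len j x) S" shows "card S < M j"
proof -
  define N where "N = (\<lambda>(a :: nat, i). if a = 0 then NY i j else NU j)"
  have "card S \<le> 1 + (\<Sum>k\<in>low j. N k)"
  proof (rule separated_trim_card_le[OF S finite_low cutoff_not_low])
    fix k A assume k: "k \<in> low j" and "separated (T k) (2 * len j x) A"
    then have A: "separated (T k) (2 * (1 / 2) ^ Suc j) A"
      using separated_mono len_bounds(1)[of j x] by (metis mult_le_cancel_left_pos zero_less_numeral)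
    show "finite A \<and> card A \<le> N k"
    proof (cases k)
      case (Pair a i)
      then show ?thesis
      proof (cases a)
        case 0
        then show ?thesis using A NY[of i j A] k Pair by (auto simp: N_def low_def)
      next
        case (Suc l)
        then show ?thesis using A NU[of j A] Pair by (simp add: N_def)
      qed
    qed
  qed
  also have "(\<Sum>k\<in>low j. N k) = (\<Sum>k\<in>Pair 0 ` I. N k) +
      (\<Sum>k\<in>(\<lambda>(l, i). (Suc l, i)) ` (SIGMA l:{..<j}. {..<M l}). N k)"
    unfolding low_def using finite_I by (intro sum.union_disjoint) auto
  also have "(\<Sum>k\<in>Pair 0 ` I. N k) = (\<Sum>i\<in>I. NY i j)"
    by (subst sum.reindex) (auto simp: N_def inj_on_def)
  also have "(\<Sum>k\<in>(\<lambda>(l, i). (Suc l, i)) ` (SIGMA l:{..<j}. {..<M l}). N k) = NU j * (\<Sum>l<j. M l)"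
    by (subst sum.reindex) (auto simp: N_def inj_on_def case_prod_unfold)
  \<comment> \<open>The summand 2 in the recursion exceeds the 1 for the part near the hub, which
    makes the inequality strict.\<close>
  finally show ?thesis using M[of j] by linarith
qed

text \<open>In fact any isometric embedding of \<open>tree x\<close> into \<open>tree y\<close> is
  refuted. Here \<open>y\<close> may be a vertex, \<open>x\<close> may not, since its legs must
  survive.\<close>

lemma not_isometric_tree:
  assumes x: "x \<in> mspace H" "x \<notin> v ` I" and y: "y \<in> mspace H" "x \<noteq> y"
  shows "\<not> isometric (tree x) (tree y)"
proof
  assume "isometric (tree x) (tree y)"
  then obtain f where f: "isometric_embedding (tree x) (tree y) f"
    unfolding isometric_def by blast
  have d: "0 < mdist H x y" by (rule mdist_pos[OF x(1) y])
  \<comment> \<open>Less than half the distance puts \<open>q k\<close> closer to \<open>y\<close>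
    than to \<open>x\<close>; less than 1 makes this difference survive the truncation in
    \<open>len\<close>.\<close>
  then obtain k where k: "mdist H (q k) y < min 1 (mdist H x y / 2)"
    using q_dense[OF y(1), of "min 1 (mdist H x y / 2)"] by auto
  have "0 < gap x"
    unfolding gap_def
  proof (rule prod_pos)
    fix l assume l: "l \<in> I"
    then have "x \<noteq> v l" using x(2) by blast
    then show "0 < mdist H x (v l)"
      by (rule mdist_pos[OF x(1) v[OF l]])
  qed
  then obtain l where l: "(1 / 2) ^ l < gap x" by (rule half_power_less)
  \<comment> \<open>Level \<open>j\<close> is governed by \<open>q k\<close>, and since
    \<open>j\<close> is at least \<open>l\<close>, \<open>gap x\<close> does not shorten its legs in
    \<open>tree x\<close>.\<close>
  define j where "j = prod_encode (k, l)"
  have "(1 / 2) ^ j \<le> (1 / 2 :: real) ^ l"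
    unfolding j_def by (rule half_power_mono) (rule le_prod_encode_2)
  then have less_gap: "len j x < gap x" using l len_bounds(2)[of j x] by linarith
  have "min 1 (mdist H y (q k)) < min 1 (mdist H x (q k))"
    using k mdist_triangle[OF x(1) q[of k] y(1)] by (auto simp: mdist_commute[of H y])
  then have less: "len j y < len j x"
    unfolding len_def j_def by simp
  define J where "J = Pair (Suc j) ` {..<M j}"
  have tips: "len j x \<in> mspace (T i) \<and> mdist (T i) (bp i) (len j x) = cutoff x i \<and> len j y < cutoff x i"
    if "i \<in> J" for i
  proof -
    have "len j x \<le> 1" using len_bounds(2)[of j x] half_power_mono[of 0 j] by simp
    then show ?thesis
      using that less less_gap len_pos[of j x] by (auto simp: J_def cutoff_simps min_def)
  qed
  note S = separated_trim_tips[of J "\<lambda>_. len j x", OF tips less_imp_le[OF len_pos]]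
  have "card ((\<lambda>i. emb i (len j x)) ` J) = M j"
    using S(2) by (simp add: J_def card_image inj_on_def)
  \<comment> \<open>The scale is \<open>len j y\<close>: below the leg length in
    \<open>tree x\<close>, yet large enough for the count in \<open>tree y\<close>.\<close>
  moreover have "card (f ` (\<lambda>i. emb i (len j x)) ` J) < M j"
    by (rule separated_tree_card_less[OF separated_image(1)[OF f S(1)]])
  ultimately show False using separated_image(2)[OF f S(1)] by simp
qed

section \<open>The map into the space of metric trees\<close>

definition rep :: "'h \<Rightarrow> real metric" where
  "rep x = (SOME R. nonempty_compact_metric R \<and> isometric (tree x) R)"

text \<open>The trees live on indexed pairs, whereas \<open>gh_space\<close> is built from metrics
  on the reals, so an isometric copy is chosen.\<close>

lemma rep: "nonempty_compact_metric (rep x)" "isometric (tree x) (rep x)"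
  using someI_ex[OF isometric_real_metric[OF compact_tree[of x]]] by (simp_all add: rep_def)

definition \<Phi> :: "'h \<Rightarrow> gh_space" where
  "\<Phi> x = abs_gh_space (rep x)"

lemma \<Phi>_tree: "\<Phi> x \<in> metric_trees"
  using metric_tree_isometric[OF rep(2) metric_tree_tree]
  by (simp add: metric_trees_def \<Phi>_def is_metric_tree_abs[OF rep(1)])

lemma \<Phi>_vertex: "i \<in> I \<Longrightarrow> \<Phi> (v i) = abs_gh_space (Y i)"
  unfolding \<Phi>_def abs_gh_space_eq_iff[OF rep(1) compact_Y]
  by (rule isometric_sym[OF isometric_trans[OF isometric_tree_vertex rep(2)]])

lemma \<Phi>_eq_imp_isometric:
  assumes "\<Phi> x = \<Phi> y" shows "isometric (tree x) (tree y)"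
proof -
  have "isometric (rep x) (rep y)"
    using assms by (simp add: \<Phi>_def abs_gh_space_eq_iff[OF rep(1) rep(1)])
  then show ?thesis
    by (rule isometric_trans[OF isometric_trans[OF rep(2)] isometric_sym[OF rep(2)]])
qed

text \<open>Passing to the real copies costs nothing: the isometries are correspondences with bound
  \<open>0\<close>, composed with the one between the trims.\<close>

lemma gh_dist_\<Phi>_le:
  assumes "\<And>k. \<bar>cutoff x k - cutoff y k\<bar> \<le> e" "0 \<le> e"
  shows "gh_dist (\<Phi> x) (\<Phi> y) \<le> e"
proof -
  have geo: "geodesic_metric (T k)" for k
    using tree_T[of k, unfolded metric_tree_def] by (rule conjunct1)
  obtain R where R: "correspondence (rep x) (tree x) 0 R"
    using correspondence_of_isometric[OF isometric_sym[OF rep(2)]] by blast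
  obtain S where S: "correspondence (tree y) (rep y) 0 S"
    using correspondence_of_isometric[OF rep(2)] by blast
  show ?thesis
    unfolding \<Phi>_def gh_dist_abs[OF rep(1) rep(1)]
    using GH_le_of_correspondence[OF rep(1) rep(1) correspondence_relcomp[OF correspondence_relcomp[OF R
          correspondence_trim[OF geo cutoff_nonneg cutoff_nonneg assms]] S]] assms(2)
    by simp
qed

lemma continuous_map_\<Phi>: "continuous_map (mtopology_of H) tree_topology \<Phi>"
proof -
  interpret G: Metric_space UNIV gh_dist by (rule Metric_space_gh_dist)
  have "continuous_map (mtopology_of H) G.mtopology \<Phi>"
    unfolding G.continuous_map_to_metric
  proof (intro ballI allI impI)
    fix x and e :: real assume "x \<in> topspace (mtopology_of H)" "0 < e"
    \<comment> \<open>Half of \<open>e\<close>, since the estimate on distances is not strict while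
      balls are open.\<close>
    then have "x \<in> mspace H" "0 < e / 2" by auto
    then obtain U where U: "openin (mtopology_of H) U" "x \<in> U"
      "\<And>y k. y \<in> U \<Longrightarrow> \<bar>cutoff x k - cutoff y k\<bar> \<le> e / 2"
      by (rule cutoff_continuous) blast
    have "\<Phi> y \<in> G.mball (\<Phi> x) e" if "y \<in> U" for y
      using gh_dist_\<Phi>_le[OF U(3)[OF that]] \<open>0 < e\<close> by (simp add: G.in_mball)
    with U show "\<exists>U. openin (mtopology_of H) U \<and> x \<in> U \<and> (\<forall>y\<in>U. \<Phi> y \<in> G.mball (\<Phi> x) e)"
      by blast
  qed
  then show ?thesis
    using \<Phi>_tree by (auto simp: tree_topology_def gh_topology_def continuous_map_in_subtopology)
qed

text \<open>A continuous map from a compact space to a Hausdorff space is closed, so only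
  injectivity remains. It is assumed on the vertices and follows from
  \<open>not_isometric_tree\<close> elsewhere.\<close>

lemma embedding_map_\<Phi>:
  assumes "compact_space (mtopology_of H)" and "inj_on \<Phi> (v ` I)"
  shows "embedding_map (mtopology_of H) tree_topology \<Phi>"
proof (rule injective_closed_imp_embedding_map[OF continuous_map_\<Phi>])
  interpret G: Metric_space UNIV gh_dist by (rule Metric_space_gh_dist)
  have "Hausdorff_space tree_topology"
    unfolding tree_topology_def gh_topology_def
    by (rule Hausdorff_space_subtopology[OF G.Hausdorff_space_mtopology])
  then show "closed_map (mtopology_of H) tree_topology \<Phi>"
    by (intro continuous_imp_closed_map_gen assms continuous_map_\<Phi> Hausdorff_imp_kc_space)
  show "inj_on \<Phi> (topspace (mtopology_of H))"
  proof (rule inj_onI, rule ccontr)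
    fix x y assume "x \<in> topspace (mtopology_of H)" "y \<in> topspace (mtopology_of H)"
      and eq: "\<Phi> x = \<Phi> y" and "x \<noteq> y"
    then have xy: "x \<in> mspace H" "y \<in> mspace H" by simp_all
    \<comment> \<open>The criterion is used in both directions, which leaves only pairs of
      vertices.\<close>
    have "x \<in> v ` I"
      using not_isometric_tree[OF xy(1) _ xy(2) \<open>x \<noteq> y\<close>] \<Phi>_eq_imp_isometric[OF eq] by blast
    moreover have "y \<in> v ` I"
      using not_isometric_tree[OF xy(2) _ xy(1) \<open>x \<noteq> y\<close>[symmetric]] \<Phi>_eq_imp_isometric[OF eq[symmetric]] by blast
    ultimately show False using assms(2) eq \<open>x \<noteq> y\<close> by (auto dest: inj_onD)
  qed
qed

end

section \<open>Choice of the data and conclusion\<close>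

theorem theorem1p1:
  fixes n :: nat and X :: "nat \<Rightarrow> gh_space" and H :: "'h metric" and v :: "nat \<Rightarrow> 'h"
  assumes "n \<ge> 1"
    and "\<And>i. i \<in> {1..n+1} \<Longrightarrow> X i \<in> metric_trees"
    and "\<And>i j. i \<in> {1..n+1} \<Longrightarrow> j \<in> {1..n+1} \<Longrightarrow> i \<noteq> j \<Longrightarrow> gh_dist (X i) (X j) > 0"
    and "compact_space (mtopology_of H)"
    and "v ` {1..n+1} \<subseteq> mspace H"
    and "inj_on v {1..n+1}"
  shows "\<exists>\<Phi>. embedding_map (mtopology_of H) tree_topology \<Phi> \<and> (\<forall>i\<in>{1..n+1}. \<Phi> (v i) = X i)"
proof -
  define I where "I = {1..n+1}"
  \<comment> \<open>The family of trees is indexed by all naturals; outside \<open>I\<close> the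
    unit segment is a placeholder.\<close>
  have "\<exists>Y. nonempty_compact_metric Y \<and> metric_tree Y \<and> (i \<in> I \<longrightarrow> X i = abs_gh_space Y)" for i
  proof (cases "i \<in> I")
    case True
    obtain Y where Y: "nonempty_compact_metric Y" "X i = abs_gh_space Y" by (rule gh_space_cases)
    then have "metric_tree Y"
      using assms(2)[of i] True by (simp add: metric_trees_def is_metric_tree_abs I_def)
    with Y show ?thesis by blast
  next
    case False
    then show ?thesis using nonempty_compact_metric_unit_segment metric_tree_unit_segment by blast
  qed
  then obtain Y where Y: "\<And>i. nonempty_compact_metric (Y i)" "\<And>i. metric_tree (Y i)"
    "\<And>i. i \<in> I \<Longrightarrow> X i = abs_gh_space (Y i)" by metis
  have "\<exists>p D. p \<in> mspace (Y i) \<and> 0 \<le> D \<and> (\<forall>z\<in>mspace (Y i). mdist (Y i) p z \<le> D)" for i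
  proof -
    obtain p D where p: "p \<in> mspace (Y i)" "\<And>z. z \<in> mspace (Y i) \<Longrightarrow> mdist (Y i) p z \<le> D"
      using mbounded_of_compact[OF Y(1)[of i]] by blast
    then have "0 \<le> D" using p(2)[OF p(1)] by simp
    with p show ?thesis by blast
  qed
  then obtain b D where bD: "\<And>i. b i \<in> mspace (Y i)" "\<And>i. 0 \<le> D i"
    "\<And>i z. z \<in> mspace (Y i) \<Longrightarrow> mdist (Y i) (b i) z \<le> D i" by metis
  have v: "v i \<in> mspace H" if "i \<in> I" for i using assms(5) that by (auto simp: I_def)
  have prod: "0 < (\<Prod>l\<in>I - {i}. mdist H (v i) (v l))" if i: "i \<in> I" for i
  proof (rule prod_pos)
    fix l assume l: "l \<in> I - {i}"
    then have "v i \<noteq> v l" using inj_onD[OF assms(6), of i l] i by (auto simp: I_def)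
    then show "0 < mdist H (v i) (v l)"
      using v[OF i] v[of l] l by (intro mdist_pos) auto
  qed
  \<comment> \<open>With this scaling the radius of the \<open>i\<close>-th tree at
    \<open>v i\<close> is exactly \<open>D i\<close>, so all of \<open>Y i\<close> is kept.\<close>
  define C where "C i = D i / (\<Prod>l\<in>I - {i}. mdist H (v i) (v l))" for i
  have "1 \<in> I" by (simp add: I_def)
  have "nonempty_compact_metric H"
    using assms(4) v[OF \<open>1 \<in> I\<close>] by (auto simp: nonempty_compact_metric_def)
  then obtain q :: "nat \<Rightarrow> 'h" where q: "\<And>k. q k \<in> mspace H"
    "\<And>x e. x \<in> mspace H \<Longrightarrow> 0 < e \<Longrightarrow> \<exists>k. mdist H (q k) x < e"
    using dense_sequence by blast
  have pos: "0 < 2 * (1 / 2 :: real) ^ Suc j" for j by simp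
  obtain NY where NY: "\<And>i j A. separated (Y i) (2 * (1 / 2) ^ Suc j) A \<Longrightarrow> finite A \<and> card A \<le> NY i j"
  proof -
    have "\<forall>i j. \<exists>N. \<forall>A. separated (Y i) (2 * (1 / 2) ^ Suc j) A \<longrightarrow> finite A \<and> card A \<le> N"
      using separated_card_bound[OF Y(1) pos] by blast
    then show ?thesis using that by metis
  qed
  obtain NU where NU: "\<And>j A. separated unit_segment (2 * (1 / 2) ^ Suc j) A \<Longrightarrow> finite A \<and> card A \<le> NU j"
  proof -
    have "\<forall>j. \<exists>N. \<forall>A. separated unit_segment (2 * (1 / 2) ^ Suc j) A \<longrightarrow> finite A \<and> card A \<le> N"
      using separated_card_bound[OF nonempty_compact_metric_unit_segment pos] by blast
    then show ?thesis using that by metis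
  qed
  obtain M where M: "\<And>j. M j = 2 + (\<Sum>i\<in>I. NY i j) + NU j * (\<Sum>l<j. M l)"
    using recursive_multiplicities[of "\<lambda>j. 2 + (\<Sum>i\<in>I. NY i j)" NU] by blast
  interpret tree_coding I Y b C H v q NY NU M
  proof
    show "finite I" by (simp add: I_def)
    show "0 \<le> C i" if "i \<in> I" for i
      using bD(2)[of i] prod[OF that] by (simp add: C_def)
    show "mdist (Y i) (b i) p \<le> C i * (\<Prod>l\<in>I - {i}. mdist H (v i) (v l))"
      if "i \<in> I" "p \<in> mspace (Y i)" for i p
      using bD(3)[OF that(2)] prod[OF that(1)] by (simp add: C_def)
    show "finite A \<and> card A \<le> NY i j"
      if "i \<in> I" "separated (Y i) (2 * (1 / 2) ^ Suc j) A" for i j A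
      by (rule NY[OF that(2)])
  qed (fact Y(1) Y(2) bD(1) v q NU M)+
  \<comment> \<open>Here the pairwise positive distances enter: distinct vertices carry
    non-isometric trees.\<close>
  have "inj_on \<Phi> (v ` I)"
  proof (rule inj_onI, rule ccontr)
    fix x y assume "x \<in> v ` I" "y \<in> v ` I" and eq: "\<Phi> x = \<Phi> y" and "x \<noteq> y"
    then obtain i j where ij: "i \<in> I" "j \<in> I" "x = v i" "y = v j" "i \<noteq> j" by blast
    then have "X i = X j" using eq \<Phi>_vertex Y(3) by simp
    moreover have "0 < gh_dist (X i) (X j)" using assms(3)[of i j] ij by (simp add: I_def)
    moreover have "gh_dist (X j) (X j) = 0"
      using Metric_space.mdist_zero[OF Metric_space_gh_dist] by simp
    ultimately show False by simp
  qed
  then have "embedding_map (mtopology_of H) tree_topology \<Phi>"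
    by (rule embedding_map_\<Phi>[OF assms(4)])
  moreover have "\<forall>i\<in>{1..n+1}. \<Phi> (v i) = X i"
    using \<Phi>_vertex Y(3) by (simp add: I_def)
  ultimately show ?thesis by blast
qed

end
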